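(* Let $V_0\in L^2(0,\infty)$ be a bounded (deterministic) probability density on $(0,\infty)$, and let $\nu$ be the probabilistic solution started from $V_0$. Then for every $\beta\in(0,\pi/\alpha-1)\subseteq(0,1)$ there exist constants $B>0$ and $\gamma\in(0,1)$ such that $$\mathbb{E}\bigl[\nu_t(0,\varepsilon)^2\bigr]\le\frac{B}{t^\gamma}\,\varepsilon^{3+\beta}\quad\text{for every }\varepsilon>0\text{ and }t\in[0,T].$$
   Context: $W$ is a standard Brownian motion on a complete filtered probability space $(\Omega,\mathcal{F},\mathbb{P})$. The constants $\mu\in\mathbb{R}$, $\sigma_M>0$, $\sigma_I>0$, $T>0$ are deterministic. Let $W^1$ be a standard Brownian motion independent of $W$, and let $X_0^1$ be a random variable with law $V_0$, independent of $W$ and $W^1$. Set $X_t^1:=X_0^1+\mu t+\sigma_MW_t+\sigma_IW_t^1$ and $\tau^1:=\inf\{s\in[0,T]:X_s^1\le0\}$. Let $\{\mathcal{F}_t^W\}_{t\in[0,T]}$ be the natural filtration of $W$. The probabilistic solution $\nu$ is the measure-valued process $\nu_t(S):=\mathbb{P}(X_t^1\in S;\,t<\tau^1\mid\mathcal{F}_t^W)$ for $t\in[0,T]$ and Lebesgue measurable $S\subseteq(0,\infty)$; $\nu_t(0,\varepsilon)$ denotes $\nu_t((0,\varepsilon))$. Also $$\rho:=\frac{\sigma_M}{\sqrt{\sigma_M^2+\sigma_I^2}}\in(0,1),\qquad \alpha:=\frac{\pi}{2}+\arcsin\rho\in(\pi/2,\pi).$$ At $t=0$ the right-hand side of the bound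 is read as $+\infty$. *)

theory Defs
  imports "HOL-Probability.Probability"
begin

definition natural_filtration :: "'a measure \<Rightarrow> (real \<Rightarrow> 'a \<Rightarrow> real) \<Rightarrow> real \<Rightarrow> 'a measure" where
  "natural_filtration M W t =
     sigma (space M) {W s -` A \<inter> space M | s A. s \<in> {0..t} \<and> A \<in> sets borel}"

text \<open>The library's \<^locale>\<open>filtration\<close> is indexed by the whole time type; only the times in
  \<open>[0, T]\<close> carry any requirement below.\<close>

definition complete_filtered_prob_space :: "'a measure \<Rightarrow> (real \<Rightarrow> 'a measure) \<Rightarrow> real \<Rightarrow> bool" where
  "complete_filtered_prob_space M F T \<longleftrightarrow>
     prob_space M \<and> complete_measure M \<and> filtration (space M) F \<and>
     (\<forall>t\<in>{0..T}. subalgebra M (F t)) \<and> null_sets M \<subseteq> sets (F 0)"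

definition standard_brownian_motion ::
  "'a measure \<Rightarrow> (real \<Rightarrow> 'a measure) \<Rightarrow> real \<Rightarrow> (real \<Rightarrow> 'a \<Rightarrow> real) \<Rightarrow> bool" where
  "standard_brownian_motion M F T W \<longleftrightarrow>
     (\<forall>t\<in>{0..T}. subalgebra M (F t) \<and> W t \<in> borel_measurable (F t)) \<and>
     (AE \<omega> in M. W 0 \<omega> = 0) \<and>
     (AE \<omega> in M. continuous_on {0..T} (\<lambda>t. W t \<omega>)) \<and>
     (\<forall>s t. 0 \<le> s \<and> s < t \<and> t \<le> T \<longrightarrow>
        distributed M lborel (\<lambda>\<omega>. W t \<omega> - W s \<omega>) (normal_density 0 (sqrt (t - s))) \<and>
        prob_space.indep_set M (sets (F s))
          (sets (vimage_algebra (space M) (\<lambda>\<omega>. W t \<omega> - W s \<omega>) borel)))"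

text \<open>\<open>X0\<close> is independent of the pair \<open>(W, W1)\<close>, so \<open>W\<close>, \<open>W1\<close>, \<open>X0\<close> are mutually independent.\<close>

definition independent_drivers ::
  "'a measure \<Rightarrow> real \<Rightarrow> (real \<Rightarrow> 'a \<Rightarrow> real) \<Rightarrow> (real \<Rightarrow> 'a \<Rightarrow> real) \<Rightarrow> ('a \<Rightarrow> real) \<Rightarrow> bool" where
  "independent_drivers M T W W1 X0 \<longleftrightarrow>
     prob_space.indep_set M
       (sets (natural_filtration M W T)) (sets (natural_filtration M W1 T)) \<and>
     prob_space.indep_set M
       (sets (vimage_algebra (space M) X0 borel))
       (sets (sigma (space M)
          (sets (natural_filtration M W T) \<union> sets (natural_filtration M W1 T))))"

text \<open>Values of \<open>V\<close> outside \<open>(0, \<infinity>)\<close> are irrelevant, and as an element of \<open>L\<^sup>2(0, \<infinity>)\<close> it is only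
  constrained up to null sets; \<open>V\<close> stands for a Borel representative.\<close>

definition bounded_L2_density :: "(real \<Rightarrow> real) \<Rightarrow> bool" where
  "bounded_L2_density V \<longleftrightarrow>
     set_borel_measurable borel {0<..} V \<and>
     (AE x in lborel. 0 < x \<longrightarrow> 0 \<le> V x) \<and>
     (\<exists>C. AE x in lborel. 0 < x \<longrightarrow> V x \<le> C) \<and>
     set_integrable lborel {0<..} (\<lambda>x. (V x)\<^sup>2) \<and>
     set_integrable lborel {0<..} V \<and> (LINT x:{0<..}|lborel. V x) = 1"

definition has_law_density :: "'a measure \<Rightarrow> ('a \<Rightarrow> real) \<Rightarrow> (real \<Rightarrow> real) \<Rightarrow> bool" where
  "has_law_density M X0 V \<longleftrightarrow>
     distributed M lborel X0 (\<lambda>x. ennreal (indicator {0<..} x * V x))"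

definition particle ::
  "real \<Rightarrow> real \<Rightarrow> real \<Rightarrow> (real \<Rightarrow> 'a \<Rightarrow> real) \<Rightarrow> (real \<Rightarrow> 'a \<Rightarrow> real) \<Rightarrow> ('a \<Rightarrow> real) \<Rightarrow>
   real \<Rightarrow> 'a \<Rightarrow> real" where
  "particle \<mu> \<sigma>M \<sigma>I W W1 X0 t \<omega> = X0 \<omega> + \<mu> * t + \<sigma>M * W t \<omega> + \<sigma>I * W1 t \<omega>"

text \<open>Extended-real valued, so that the infimum over the empty set (no hit before \<open>T\<close>) is \<open>\<infinity>\<close>.\<close>

definition hitting_time :: "real \<Rightarrow> (real \<Rightarrow> 'a \<Rightarrow> real) \<Rightarrow> 'a \<Rightarrow> ereal" where
  "hitting_time T X \<omega> = (INF s\<in>{s\<in>{0..T}. X s \<omega> \<le> 0}. ereal s)"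

text \<open>\<open>\<nu>\<close> is a measure-valued version of the conditional probabilities
  \<open>\<nu>\<^sub>t(S) = P(X\<^sub>t \<in> S, t < \<tau> | F\<^sub>t\<^sup>W)\<close>, which are determined almost surely for each fixed \<open>t\<close> and \<open>S\<close>.\<close>

definition probabilistic_solution ::
  "'a measure \<Rightarrow> real \<Rightarrow> (real \<Rightarrow> 'a \<Rightarrow> real) \<Rightarrow> (real \<Rightarrow> 'a \<Rightarrow> real) \<Rightarrow>
   (real \<Rightarrow> 'a \<Rightarrow> real measure) \<Rightarrow> bool" where
  "probabilistic_solution M T W X \<nu> \<longleftrightarrow>
     (\<forall>t\<in>{0..T}.
        (\<forall>\<omega>\<in>space M. sets (\<nu> t \<omega>) = sets (lebesgue_on {0<..})) \<and>
        (\<forall>S\<in>sets lebesgue. S \<subseteq> {0<..} \<longrightarrow>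
           (AE \<omega> in M. emeasure (\<nu> t \<omega>) S =
              nn_cond_exp M (natural_filtration M W t)
                (indicator {\<omega>\<in>space M. X t \<omega> \<in> S \<and> ereal t < hitting_time T X \<omega>}) \<omega>)))"

definition correlation :: "real \<Rightarrow> real \<Rightarrow> real" where
  "correlation \<sigma>M \<sigma>I = \<sigma>M / sqrt (\<sigma>M\<^sup>2 + \<sigma>I\<^sup>2)"

definition wedge_angle :: "real \<Rightarrow> real \<Rightarrow> real" where
  "wedge_angle \<sigma>M \<sigma>I = pi / 2 + arcsin (correlation \<sigma>M \<sigma>I)"

end

theory Submission
  imports Defs
begin

text \<open>
  Conditionally on \<open>W\<close>, two particles with independent initial positions and idiosyncratic noises are
  independent. So \<open>E[\<nu>\<^sub>t(0, \<epsilon>)\<^sup>2]\<close> is the probability that two particles sharing the common noise are both alive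
  and in \<open>(0, \<epsilon>)\<close> at time \<open>t\<close>. As the initial density is at most some \<open>C\<close>, reversing time bounds this by
  \<open>C\<^sup>2\<close> times the integral, over starting points in \<open>(0, \<epsilon>)\<^sup>2\<close>, of the probability that a correlated planar Brownian
  motion with drift stays in the quadrant up to time \<open>t\<close>. The square has area \<open>\<epsilon>\<^sup>2\<close>; the remaining power
  \<open>\<epsilon>\<^bsup>1 + \<beta>\<^esup>\<close> has to come from the survival probability.

  A linear map turns the correlated motion into a standard one and the quadrant into a wedge, whose
  angle is at most \<open>\<alpha> = wedge_angle\<close>. For \<open>1 + \<beta> < p < \<pi> / \<alpha>\<close> the harmonic function \<open>Re (z\<^sup>p)\<close> is comparable
  with \<open>\<bar>z\<bar>\<^sup>p\<close> on the wedge. As \<open>p < 2\<close>, the function \<open>A Re (z\<^sup>p) - \<bar>z\<bar>\<^sup>2\<close> is nonnegative near the apex, and the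
  generator maps it to \<open>- 2\<close> plus a drift term that is small near the apex. Capped at a constant level, and up to
  exponential growth in time, it is a supersolution that decreases at a positive rate while the process
  survives. Hence \<open>t * P(survival up to t)\<close> is at most a constant times its initial value, which is of order \<open>\<epsilon>\<^sup>p\<close>
  (lemmas \<open>barrier_step\<close>, \<open>pair_survival_le_barrier\<close>, \<open>pair_survival_bound\<close>). As a probability is also at most
  \<open>1\<close>, it is at most \<open>(K \<epsilon>\<^sup>p / t)\<^sup>\<gamma>\<close> with \<open>\<gamma> = (1 + \<beta>) / p < 1\<close>, which is the claim.

  The argument is carried out on a time grid: killing at the grid times only makes survival more likely,
  and the increments are then finitely many independent normal variables. The generator is replaced by one
  Gaussian step and a Taylor expansion with cubic remainder. To keep away from the singularity of \<open>z\<^sup>p\<close>, the wedge is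
  shifted by an amount of order \<open>\<epsilon>\<close>; the mesh of the grid may depend on \<open>\<epsilon>\<close>, while the final constants do not.
  The passage from \<open>\<nu>\<close> to two particles is a recursion for the conditional density of the killed particle
  given \<open>W\<close> (lemmas \<open>alive_expectation\<close> and \<open>filter_density_second_moment\<close>); its second moments obey the backward
  recursion for the two-particle survival probability, so the time reversal is built in.
\<close>

section \<open>Moments of Gaussian steps\<close>

text \<open>The value of \<open>E[\<bar>G\<bar>\<^sup>3]\<close>, by which the cubic Taylor remainder of a Gaussian step is bounded.\<close>

definition std_normal_abs_moment3 :: real where
  "std_normal_abs_moment3 = sqrt (2 / pi) * 2"

lemma std_normal_abs_moment3_nonneg: "0 \<le> std_normal_abs_moment3"
  by (simp add: std_normal_abs_moment3_def)

text \<open>Nonnegativity of the integrand makes the nonnegative and the signed integral agree, so that the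
  signed moments (odd ones vanish, the second is one) compute the former. The second conclusion
  keeps this property for the value, so that the lemma can be iterated over several variables.\<close>

lemma nn_integral_std_normal_cubic_bound:
  fixes a b c l :: real
  assumes nonneg: "\<And>x. 0 \<le> a + b * x + c * x\<^sup>2 + l * \<bar>x\<bar> ^ 3"
  shows "(\<integral>\<^sup>+x. ennreal (a + b * x + c * x\<^sup>2 + l * \<bar>x\<bar> ^ 3) \<partial>std_normal_distribution)
           = ennreal (a + c + l * std_normal_abs_moment3)" (is ?eq)
    and "0 \<le> a + c + l * std_normal_abs_moment3" (is ?nn)
proof -
  let ?P = "\<lambda>x. a + b * x + c * x\<^sup>2 + l * \<bar>x\<bar> ^ 3"
  have "has_bochner_integral lborel
      (\<lambda>x. a * (std_normal_density x * x ^ (2 * 0)) + b * (std_normal_density x * x ^ (2 * 0 + 1))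
         + c * (std_normal_density x * x ^ (2 * 1))
         + l * (std_normal_density x * \<bar>x\<bar> ^ (2 * 1 + 1)))
      (a * (fact (2 * 0) / (2 ^ 0 * fact 0)) + b * 0 + c * (fact (2 * 1) / (2 ^ 1 * fact 1))
         + l * (sqrt (2 / pi) * 2 ^ 1 * fact 1))"
    by (intro has_bochner_integral_add has_bochner_integral_mult_right
        std_normal_moment_even std_normal_moment_odd std_normal_moment_abs_odd)
  then have H: "has_bochner_integral lborel (\<lambda>x. std_normal_density x * ?P x)
      (a + c + l * std_normal_abs_moment3)"
    by (simp add: algebra_simps std_normal_abs_moment3_def numeral_3_eq_3 power2_eq_square)
  have pos: "0 \<le> std_normal_density x * ?P x" for x
    using nonneg by (intro mult_nonneg_nonneg) auto
  show ?nn
    using pos has_bochner_integral_integral_eq[OF H] by (metis (no_types, lifting) integral_nonneg_AE AE_I2)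
  have "(\<integral>\<^sup>+x. ennreal (?P x) \<partial>std_normal_distribution)
      = (\<integral>\<^sup>+x. ennreal (std_normal_density x * ?P x) \<partial>lborel)"
    by (subst nn_integral_density) (auto simp: ennreal_mult nonneg intro!: nn_integral_cong)
  also have "\<dots> = ennreal (a + c + l * std_normal_abs_moment3)"
    using pos H has_bochner_integral_integral_eq[OF H] integrable.intros[OF H]
    by (subst nn_integral_eq_integral) auto
  finally show ?eq .
qed

lemma nn_integral_std_normal3_quadratic:
  fixes a b1 b2 b3 c1 c2 c3 d12 d13 d23 l :: real
  assumes nonneg: "\<And>x y z. 0 \<le> a + b1 * x + b2 * y + b3 * z + c1 * x\<^sup>2 + c2 * y\<^sup>2 + c3 * z\<^sup>2
           + d12 * x * y + d13 * x * z + d23 * y * z + l * (\<bar>x\<bar> ^ 3 + \<bar>y\<bar> ^ 3 + \<bar>z\<bar> ^ 3)"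
  shows "(\<integral>\<^sup>+x. \<integral>\<^sup>+y. \<integral>\<^sup>+z. ennreal (a + b1 * x + b2 * y + b3 * z + c1 * x\<^sup>2 + c2 * y\<^sup>2 + c3 * z\<^sup>2
           + d12 * x * y + d13 * x * z + d23 * y * z + l * (\<bar>x\<bar> ^ 3 + \<bar>y\<bar> ^ 3 + \<bar>z\<bar> ^ 3))
           \<partial>std_normal_distribution \<partial>std_normal_distribution \<partial>std_normal_distribution)
         = ennreal (a + c1 + c2 + c3 + 3 * l * std_normal_abs_moment3)" (is ?eq)
    and "0 \<le> a + c1 + c2 + c3 + 3 * l * std_normal_abs_moment3" (is ?nn)
proof -
  let ?m = "std_normal_abs_moment3"
  define A1 where "A1 x y = a + b1 * x + b2 * y + c1 * x\<^sup>2 + c2 * y\<^sup>2 + d12 * x * y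
      + l * (\<bar>x\<bar> ^ 3 + \<bar>y\<bar> ^ 3)" for x y
  define B1 where "B1 x y = b3 + d13 * x + d23 * y" for x y
  have e1: "a + b1 * x + b2 * y + b3 * z + c1 * x\<^sup>2 + c2 * y\<^sup>2 + c3 * z\<^sup>2
           + d12 * x * y + d13 * x * z + d23 * y * z + l * (\<bar>x\<bar> ^ 3 + \<bar>y\<bar> ^ 3 + \<bar>z\<bar> ^ 3)
         = A1 x y + B1 x y * z + c3 * z\<^sup>2 + l * \<bar>z\<bar> ^ 3" for x y z
    by (simp add: A1_def B1_def algebra_simps)
  note n1 = nonneg[unfolded e1]
  note i1 = nn_integral_std_normal_cubic_bound[of "A1 x y" "B1 x y" c3 l for x y, OF n1]
  define A2 where "A2 x = a + b1 * x + c1 * x\<^sup>2 + l * \<bar>x\<bar> ^ 3 + c3 + l * ?m" for x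
  define B2 where "B2 x = b2 + d12 * x" for x
  have e2: "A1 x y + c3 + l * ?m = A2 x + B2 x * y + c2 * y\<^sup>2 + l * \<bar>y\<bar> ^ 3" for x y
    by (simp add: A1_def A2_def B2_def algebra_simps)
  note i2 = nn_integral_std_normal_cubic_bound[of "A2 x" "B2 x" c2 l for x, OF i1(2)[unfolded e2]]
  have e3: "A2 x + c2 + l * ?m = (a + c2 + c3 + 2 * l * ?m) + b1 * x + c1 * x\<^sup>2 + l * \<bar>x\<bar> ^ 3" for x
    by (simp add: A2_def algebra_simps)
  note i3 = nn_integral_std_normal_cubic_bound[of "a + c2 + c3 + 2 * l * ?m" b1 c1 l,
      OF i2(2)[unfolded e3]]
  have e4: "a + c2 + c3 + 2 * l * ?m + c1 + l * ?m = a + c1 + c2 + c3 + 3 * l * ?m"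
    by simp
  show ?eq unfolding e1 i1(1) e2 i2(1) e3 i3(1) e4 ..
  show ?nn using i3(2) unfolding e4 .
qed


text \<open>\<open>X + \<i>Y\<close> is the increment of a planar Brownian motion with drift over a step of length \<open>h\<^sup>2\<close>,
  written in terms of three independent standard normal variables: the two conditions say that
  \<open>X\<close> and \<open>Y\<close> both have variance \<open>h\<^sup>2\<close>, and their covariance vanishes by symmetry in \<open>y\<close> and \<open>z\<close>.
  Hence only the means and the two variances survive in the expectation.\<close>

lemma nn_integral_std_normal3_quadratic_forms:
  fixes P0 L1 L2 Q11 Q12 Q22 e h c0 c1 r l :: real
  defines "X \<equiv> \<lambda>x y z. e - h * (c0 * x + c1 * y + c1 * z)"
    and "Y \<equiv> \<lambda>y z. - (h * r * (y - z))"
  assumes c: "c0\<^sup>2 + 2 * c1\<^sup>2 = 1" and r: "2 * r\<^sup>2 = 1"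
  assumes nonneg: "\<And>x y z. 0 \<le> P0 + L1 * X x y z + L2 * Y y z + Q11 * (X x y z)\<^sup>2
     + Q12 * X x y z * Y y z + Q22 * (Y y z)\<^sup>2 + l * (1 + (\<bar>x\<bar> ^ 3 + \<bar>y\<bar> ^ 3 + \<bar>z\<bar> ^ 3))"
  shows "(\<integral>\<^sup>+x. \<integral>\<^sup>+y. \<integral>\<^sup>+z. ennreal (P0 + L1 * X x y z + L2 * Y y z + Q11 * (X x y z)\<^sup>2
     + Q12 * X x y z * Y y z + Q22 * (Y y z)\<^sup>2 + l * (1 + (\<bar>x\<bar> ^ 3 + \<bar>y\<bar> ^ 3 + \<bar>z\<bar> ^ 3)))
           \<partial>std_normal_distribution \<partial>std_normal_distribution \<partial>std_normal_distribution)
       = ennreal (P0 + L1 * e + Q11 * (e\<^sup>2 + h\<^sup>2) + Q22 * h\<^sup>2 + l * (1 + 3 * std_normal_abs_moment3))"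
      (is ?eq)
    and "0 \<le> P0 + L1 * e + Q11 * (e\<^sup>2 + h\<^sup>2) + Q22 * h\<^sup>2 + l * (1 + 3 * std_normal_abs_moment3)"
      (is ?nn)
proof -
  define k1 k2 k3 where "k1 = Q11 * h\<^sup>2 * c0\<^sup>2"
    and "k2 = h\<^sup>2 * (Q11 * c1\<^sup>2 + Q12 * c1 * r + Q22 * r\<^sup>2)"
    and "k3 = h\<^sup>2 * (Q11 * c1\<^sup>2 - Q12 * c1 * r + Q22 * r\<^sup>2)"
  have eq: "P0 + L1 * X x y z + L2 * Y y z + Q11 * (X x y z)\<^sup>2
     + Q12 * X x y z * Y y z + Q22 * (Y y z)\<^sup>2 + l * (1 + (\<bar>x\<bar> ^ 3 + \<bar>y\<bar> ^ 3 + \<bar>z\<bar> ^ 3))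
    = (P0 + L1 * e + Q11 * e\<^sup>2 + l)
      + (- h * c0 * L1 - 2 * e * h * c0 * Q11) * x
      + (- h * c1 * L1 - h * r * L2 - 2 * e * h * c1 * Q11 - e * h * r * Q12) * y
      + (- h * c1 * L1 + h * r * L2 - 2 * e * h * c1 * Q11 + e * h * r * Q12) * z
      + k1 * x\<^sup>2 + k2 * y\<^sup>2 + k3 * z\<^sup>2
      + (h\<^sup>2 * (2 * Q11 * c0 * c1 + Q12 * c0 * r)) * x * y
      + (h\<^sup>2 * (2 * Q11 * c0 * c1 - Q12 * c0 * r)) * x * z
      + (h\<^sup>2 * (2 * Q11 * c1\<^sup>2 - 2 * Q22 * r\<^sup>2)) * y * z
      + l * (\<bar>x\<bar> ^ 3 + \<bar>y\<bar> ^ 3 + \<bar>z\<bar> ^ 3)" for x y z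
    unfolding X_def Y_def k1_def k2_def k3_def by algebra
  have "k1 + k2 + k3 = Q11 * h\<^sup>2 * (c0\<^sup>2 + 2 * c1\<^sup>2) + Q22 * h\<^sup>2 * (2 * r\<^sup>2)"
    unfolding k1_def k2_def k3_def by algebra
  then have k: "k1 + k2 + k3 = Q11 * h\<^sup>2 + Q22 * h\<^sup>2" by (simp only: c r mult_1_right)
  then have sum: "P0 + L1 * e + Q11 * e\<^sup>2 + l + k1 + k2 + k3 + 3 * l * std_normal_abs_moment3
    = P0 + L1 * e + Q11 * (e\<^sup>2 + h\<^sup>2) + Q22 * h\<^sup>2 + l * (1 + 3 * std_normal_abs_moment3)"
    by (simp add: algebra_simps)
  note I = nn_integral_std_normal3_quadratic[OF nonneg[unfolded eq]]
  show ?eq unfolding eq I(1) sum ..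
  show ?nn using I(2) unfolding sum .
qed

lemma cube_sum4_le:
  fixes x y z :: real assumes "0 \<le> x" "0 \<le> y" "0 \<le> z"
  shows "(1 + x + y + z) ^ 3 \<le> 16 * (1 + (x ^ 3 + y ^ 3 + z ^ 3))"
proof -
  have c: "(u + v) ^ 3 \<le> 4 * (u ^ 3 + v ^ 3)" if "0 \<le> u" "0 \<le> v" for u v :: real
  proof -
    \<comment> \<open>the gap in the power mean inequality is an explicit nonnegative cubic\<close>
    have "4 * (u ^ 3 + v ^ 3) - (u + v) ^ 3 = 3 * (u + v) * (u - v)\<^sup>2" by algebra
    moreover have "0 \<le> 3 * (u + v) * (u - v)\<^sup>2" using that by simp
    ultimately show ?thesis by linarith
  qed
  have "(1 + x + y + z) ^ 3 = ((1 + x) + (y + z)) ^ 3" by (simp add: add.assoc)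
  also have "\<dots> \<le> 4 * ((1 + x) ^ 3 + (y + z) ^ 3)" using assms by (intro c) auto
  also have "\<dots> \<le> 4 * (4 * (1 ^ 3 + x ^ 3) + 4 * (y ^ 3 + z ^ 3))"
    using c[of 1 x] c[of y z] assms by (intro mult_left_mono add_mono) auto
  finally show ?thesis by simp
qed

section \<open>Powers on a wedge\<close>

text \<open>On a wedge of half-angle \<open>\<theta>\<close> around the positive real axis, \<open>\<bar>arg z\<bar> \<le> \<theta>\<close> and
  \<open>Re (z\<^sup>p) = \<bar>z\<bar>\<^sup>p cos (p arg z)\<close>; as \<open>p \<theta> \<le> \<pi>/2\<close>, the cosine is smallest at the edge. The wedge is
  expressed through the cosine of the angle to stay with algebraic inequalities.\<close>

lemma cos_times_norm_powr_le_Re_powr: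
  fixes z :: complex and p \<theta> :: real
  assumes z: "0 < Re z" "cos \<theta> * norm z \<le> Re z"
    and \<theta>: "0 \<le> \<theta>" "0 \<le> p" "p * \<theta> \<le> pi / 2" "\<theta> \<le> pi"
  shows "cos (p * \<theta>) * norm z powr p \<le> Re (z powr of_real p)"
proof -
  have z0: "z \<noteq> 0" using z by auto
  have "cos (Arg z) = Re z / norm z" using cos_Arg z0 by blast
  then have "cos \<theta> \<le> cos \<bar>Arg z\<bar>" using z z0 by (simp add: le_divide_eq)
  moreover have "\<bar>Arg z\<bar> \<le> pi" using Arg_bounded[of z] by (auto simp: abs_le_iff)
  ultimately have arg: "\<bar>Arg z\<bar> \<le> \<theta>"
    using cos_mono_le_eq[of \<theta> "\<bar>Arg z\<bar>"] \<theta> by auto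
  have "p * \<bar>Arg z\<bar> \<le> p * \<theta>" using arg \<theta> by (intro mult_left_mono) auto
  then have "cos (p * \<theta>) \<le> cos (p * \<bar>Arg z\<bar>)"
    using \<theta> by (intro cos_monotone_0_pi_le) auto
  also have "\<dots> = cos (p * Arg z)" by (cases "Arg z \<ge> 0") auto
  finally have c: "cos (p * \<theta>) \<le> cos (p * Arg z)" .
  have "Re (z powr of_real p) = norm z powr p * cos (p * Arg z)"
    using z0 by (simp add: powr_def Re_exp Arg_eq_Im_Ln)
  then show ?thesis using mult_right_mono[OF c, of "norm z powr p"] by (simp add: mult.commute)
qed

lemma norm_powr_of_real:
  fixes z :: complex assumes "0 < Re z"
  shows "norm (z powr of_real q) = norm z powr q"
  using assms by (auto simp: powr_def Re_exp)

text \<open>Taylor's theorem on the half-plane \<open>{u. r \<le> Re u}\<close>, which is convex and contains both \<open>z\<close> and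
  \<open>z + w\<close>: there \<open>\<bar>u\<bar> \<ge> r\<close>, so the third derivative \<open>p (p - 1) (p - 2) u\<^bsup>p - 3\<^esup>\<close> is bounded by
  \<open>2 r\<^bsup>p - 3\<^esup>\<close>.\<close>

lemma powr_Taylor2_bound:
  fixes z w :: complex and p r :: real
  assumes p: "1 < p" "p < 2" and r: "0 < r" "2 * r \<le> Re z" "norm w \<le> r"
  shows "norm ((z + w) powr of_real p - (z powr of_real p + p * z powr of_real (p - 1) * w
          + p * (p - 1) / 2 * z powr of_real (p - 2) * w\<^sup>2)) \<le> r powr (p - 3) * norm w ^ 3"
proof -
  define S where "S = {u. r \<le> Re u}"
  define f where "f i u = of_real (\<Prod>j<i. p - real j) * u powr of_real (p - real i)"
    for i and u :: complex
  have S: "convex S" unfolding S_def by (rule convex_halfspace_Re_ge)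
  have Re_w: "Re w \<ge> - r" using r abs_Re_le_cmod[of w] by linarith
  have zS: "z \<in> S" "z + w \<in> S" using r Re_w by (auto simp: S_def)
  have der: "(f i has_field_derivative f (Suc i) u) (at u within S)" if "u \<in> S" for i u
  proof -
    have "u \<notin> \<real>\<^sub>\<le>\<^sub>0" using that r by (auto simp: S_def complex_nonpos_Reals_iff)
    then show ?thesis unfolding f_def
      by (auto intro!: derivative_eq_intros simp: algebra_simps)
  qed
  have B: "cmod (f (Suc 2) u) \<le> 2 * r powr (p - 3)" if "u \<in> S" for u
  proof -
    have Re: "0 < Re u" "r \<le> norm u" using that r complex_Re_le_cmod[of u] by (auto simp: S_def)
    have "norm (f 3 u) = \<bar>p * (p - 1) * (p - 2)\<bar> * norm u powr (p - 3)"
      unfolding f_def using Re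
      by (simp only: norm_mult norm_of_real of_nat_numeral norm_powr_of_real)
         (simp add: numeral_3_eq_3 lessThan_Suc mult_ac)
    also have "\<dots> \<le> 2 * r powr (p - 3)"
    proof (rule mult_mono)
      have "p * (p - 1) * (2 - p) \<le> 2 * 1 * 1" using p by (intro mult_mono) auto
      then show "\<bar>p * (p - 1) * (p - 2)\<bar> \<le> 2"
        using p by (simp add: abs_mult)
      show "norm u powr (p - 3) \<le> r powr (p - 3)"
        using Re r p by (intro powr_mono2') auto
    qed auto
    finally show ?thesis by (simp add: numeral_3_eq_3 numeral_2_eq_2)
  qed
  have "cmod (f 0 (z + w) - (\<Sum>i\<le>2. f i z * ((z + w) - z) ^ i / fact i))
      \<le> 2 * r powr (p - 3) * cmod ((z + w) - z) ^ Suc 2 / fact 2"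
    by (rule complex_Taylor[OF S der B zS])
  also have "\<dots> = r powr (p - 3) * norm w ^ 3" by (simp add: numeral_3_eq_3)
  also have "f 0 (z + w) = (z + w) powr of_real p" by (simp add: f_def)
  also have "(\<Sum>i\<le>2. f i z * ((z + w) - z) ^ i / fact i)
     = z powr of_real p + p * z powr of_real (p - 1) * w
          + p * (p - 1) / 2 * z powr of_real (p - 2) * w\<^sup>2"
    by (simp add: f_def numeral_2_eq_2 lessThan_Suc mult_ac)
  finally show ?thesis .
qed

section \<open>The barrier function\<close>

text \<open>\<open>p\<close> lies strictly below the critical exponent \<open>\<pi> / wedge_angle\<close>, so that \<open>Re (z\<^sup>p)\<close> stays comparable
  with \<open>\<bar>z\<bar>\<^sup>p\<close> up to the edge of the wedge.\<close>

locale wedge_barrier =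
  fixes \<mu> \<sigma>M \<sigma>I p :: real
  assumes \<sigma>M: "0 < \<sigma>M" and \<sigma>I: "0 < \<sigma>I" and p: "1 < p" "p * wedge_angle \<sigma>M \<sigma>I < pi"
begin

text \<open>For two particles at \<open>x\<close> and \<open>y\<close> with the same common noise and independent idiosyncratic noises, the
  increments of \<open>x + y\<close> and \<open>x - y\<close> are independent with variances \<open>a\<^sup>2\<close> and \<open>b\<^sup>2\<close> per unit of time. So
  \<open>(x + y) / a + \<i> (x - y) / b\<close> is a standard planar Brownian motion, with drift \<open>2\<mu> / a\<close> along the real
  axis, and the quadrant becomes a wedge around that axis. The sign in \<open>m\<close> is the reversal of time:
  the backward recursion below subtracts the increments.

  \<open>\<kappa>\<close> is the constant in \<open>\<kappa> \<bar>z\<bar>\<^sup>p \<le> Re (z\<^sup>p)\<close>. The radius \<open>R\<close> is so small that on the disc of radius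
  \<open>R\<close> the drift contributes at most \<open>1\<close> to the generator applied to \<open>g\<close>, half of the decrease \<open>2\<close>
  produced by \<open>- \<bar>z\<bar>\<^sup>2\<close>. The factor \<open>8\<close> in \<open>A\<close> makes \<open>g\<close> exceed \<open>R\<^sup>2\<close> already at \<open>\<bar>z\<bar> = R / 2\<close>, so that
  capping \<open>g\<close> at the level \<open>R\<^sup>2\<close> happens well inside the disc.\<close>

definition a :: real where "a = sqrt (4 * \<sigma>M\<^sup>2 + 2 * \<sigma>I\<^sup>2)"
definition b :: real where "b = sqrt 2 * \<sigma>I"
definition \<kappa> :: real where "\<kappa> = cos (p * (wedge_angle \<sigma>M \<sigma>I / 2))"
definition m :: real where "m = - (2 * \<mu> / a)"
definition R :: real where "R = 1 / ((\<bar>m\<bar> + 1) * (16 / \<kappa> + 2))"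
definition A :: real where "A = 8 * R powr (2 - p) / \<kappa>"
definition wedge :: "complex set" where "wedge = {z. 0 < Re z \<and> b * \<bar>Im z\<bar> \<le> a * Re z}"
definition g :: "complex \<Rightarrow> real" where "g z = A * Re (z powr of_real p) - (norm z)\<^sup>2"

text \<open>The shift by \<open>2 e\<close> moves the quadrant away from the apex of the wedge, where \<open>z\<^sup>p\<close> is singular, to
  distance of order \<open>e\<close>. The square \<open>(0, e)\<^sup>2\<close> stays within a multiple of \<open>e\<close> of the apex.\<close>

definition point :: "real \<Rightarrow> real \<Rightarrow> real \<Rightarrow> complex" where
  "point e x y = Complex ((x + y + 2 * e) / a) ((x - y) / b)"

text \<open>The minimum of two supersolutions. The value is \<open>0\<close> off the quadrant because the killed process has
  no future there.\<close>

definition barrier :: "real \<Rightarrow> real \<Rightarrow> real \<Rightarrow> real" where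
  "barrier e x y = (if 0 < x \<and> 0 < y then
     (if norm (point e x y) \<le> R then min (R\<^sup>2) (g (point e x y)) else R\<^sup>2) else 0)"

lemma a_sq: "a\<^sup>2 = 4 * \<sigma>M\<^sup>2 + 2 * \<sigma>I\<^sup>2" and b_sq: "b\<^sup>2 = 2 * \<sigma>I\<^sup>2"
  by (simp_all add: a_def b_def power_mult_distrib)

lemma b_pos: "0 < b" using \<sigma>I by (simp add: b_def)

lemma b_le_a: "b \<le> a"
proof -
  have "b\<^sup>2 \<le> a\<^sup>2" by (simp add: a_sq b_sq)
  then show ?thesis by (rule power2_le_imp_le) (simp add: a_def)
qed

lemma a_pos: "0 < a" using b_pos b_le_a by linarith

lemma correlation_bounds: "0 < correlation \<sigma>M \<sigma>I" "correlation \<sigma>M \<sigma>I < 1"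
proof -
  have "0 < \<sigma>I\<^sup>2" using \<sigma>I by simp
  then have "\<sigma>M < sqrt (\<sigma>M\<^sup>2 + \<sigma>I\<^sup>2)" by (intro real_less_rsqrt) simp
  moreover from this have "0 < sqrt (\<sigma>M\<^sup>2 + \<sigma>I\<^sup>2)" using \<sigma>M by linarith
  ultimately show "0 < correlation \<sigma>M \<sigma>I" "correlation \<sigma>M \<sigma>I < 1"
    unfolding correlation_def using \<sigma>M by (auto simp only: divide_less_eq_1_pos zero_less_divide_iff)
qed

lemma wedge_angle_bounds: "pi / 2 < wedge_angle \<sigma>M \<sigma>I" "wedge_angle \<sigma>M \<sigma>I < pi"
  using correlation_bounds arcsin_less_mono[of 0 "correlation \<sigma>M \<sigma>I"]
    arcsin_less_mono[of "correlation \<sigma>M \<sigma>I" 1]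
  by (auto simp: wedge_angle_def)

text \<open>The wedge angle exceeds a right angle because the particles are positively correlated. \<open>p < 2\<close> is
  what makes \<open>\<bar>z\<bar>\<^sup>2\<close> negligible against \<open>\<bar>z\<bar>\<^sup>p\<close> near the apex.\<close>

lemma p_less_2: "p < 2"
proof -
  have "p * (pi / 2) < p * wedge_angle \<sigma>M \<sigma>I"
    using p wedge_angle_bounds by (intro mult_strict_left_mono) auto
  then have "p * (pi / 2) < 2 * (pi / 2)" using p by linarith
  then show ?thesis by (rule mult_right_less_imp_less) simp
qed

lemma \<kappa>_bounds: "0 < \<kappa>" "\<kappa> \<le> 1"
proof -
  have "0 < p * wedge_angle \<sigma>M \<sigma>I"
    using p wedge_angle_bounds pi_gt_zero by (intro mult_pos_pos) linarith+
  then show "0 < \<kappa>" "\<kappa> \<le> 1"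
    unfolding \<kappa>_def using p by (auto intro!: cos_gt_zero_pi)
qed

lemma R_bounds: "0 < R" "R \<le> 1" "\<bar>m\<bar> * (16 / \<kappa> + 2) * R \<le> 1"
proof -
  have q: "2 \<le> 16 / \<kappa> + 2" using \<kappa>_bounds by auto
  have "1 * 1 \<le> (\<bar>m\<bar> + 1) * (16 / \<kappa> + 2)" using q by (intro mult_mono) auto
  moreover have "\<bar>m\<bar> * (16 / \<kappa> + 2) \<le> (\<bar>m\<bar> + 1) * (16 / \<kappa> + 2)"
    using q by (intro mult_right_mono) auto
  ultimately show "0 < R" "R \<le> 1" "\<bar>m\<bar> * (16 / \<kappa> + 2) * R \<le> 1"
    unfolding R_def by (auto simp: divide_simps)
qed

lemma A_pos: "0 < A" using \<kappa>_bounds R_bounds by (simp add: A_def)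

lemma A_times: "A * \<kappa> = 8 * R powr (2 - p)" using \<kappa>_bounds by (simp add: A_def)

text \<open>The image of the quadrant has full angle \<open>2\<theta>\<^sub>0\<close> with \<open>cos (2\<theta>\<^sub>0) = - \<rho>\<^sup>2\<close>, the correlation of the two
  particles being \<open>\<rho>\<^sup>2\<close>, whereas \<open>wedge_angle\<close> has cosine \<open>- \<rho>\<close>. As \<open>\<rho>\<^sup>2 \<le> \<rho>\<close>, the image is contained in
  the wedge of angle \<open>wedge_angle\<close>.\<close>

lemma Re_powr_wedge:
  assumes "z \<in> wedge"
  shows "\<kappa> * norm z powr p \<le> Re (z powr of_real p)"
  unfolding \<kappa>_def
proof (rule cos_times_norm_powr_le_Re_powr)
  let ?\<rho> = "correlation \<sigma>M \<sigma>I" and ?\<theta> = "wedge_angle \<sigma>M \<sigma>I / 2"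
  have Re: "0 < Re z" and Im: "b * \<bar>Im z\<bar> \<le> a * Re z" using assms by (auto simp: wedge_def)
  show "0 < Re z" by fact
  have \<rho>sq: "?\<rho>\<^sup>2 = \<sigma>M\<^sup>2 / (\<sigma>M\<^sup>2 + \<sigma>I\<^sup>2)" by (simp add: correlation_def power_divide)
  have "cos (2 * ?\<theta>) = - ?\<rho>"
    using correlation_bounds by (simp add: wedge_angle_def cos_add del: distrib_left_numeral)
  then have c2: "2 * (cos ?\<theta>)\<^sup>2 = 1 - ?\<rho>" by (simp only: cos_double_cos) 
  have "(b * \<bar>Im z\<bar>)\<^sup>2 \<le> (a * Re z)\<^sup>2" using Im b_pos by (intro power_mono) auto
  then have "\<sigma>I\<^sup>2 * (Im z)\<^sup>2 \<le> (2 * \<sigma>M\<^sup>2 + \<sigma>I\<^sup>2) * (Re z)\<^sup>2"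
    unfolding power_mult_distrib a_sq b_sq power2_abs by (simp add: algebra_simps)
  then have n: "\<sigma>I\<^sup>2 * (norm z)\<^sup>2 \<le> 2 * (\<sigma>M\<^sup>2 + \<sigma>I\<^sup>2) * (Re z)\<^sup>2"
    by (simp add: cmod_power2 algebra_simps)
  have "(1 - ?\<rho>) \<le> (1 - ?\<rho>) * (1 + ?\<rho>)" using correlation_bounds by (simp add: algebra_simps)
  also have "\<dots> = 1 - ?\<rho>\<^sup>2" by (simp add: algebra_simps power2_eq_square)
  also have "\<dots> = \<sigma>I\<^sup>2 / (\<sigma>M\<^sup>2 + \<sigma>I\<^sup>2)" using \<sigma>M by (simp add: \<rho>sq field_simps sum_power2_eq_zero_iff)
  finally have "(1 - ?\<rho>) * (norm z)\<^sup>2 \<le> \<sigma>I\<^sup>2 / (\<sigma>M\<^sup>2 + \<sigma>I\<^sup>2) * (norm z)\<^sup>2"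
    by (rule mult_right_mono) simp
  also have "\<dots> \<le> 2 * (Re z)\<^sup>2"
    using n \<sigma>M by (simp add: field_simps sum_power2_gt_zero_iff pos_divide_le_eq)
  finally have "(cos ?\<theta> * norm z)\<^sup>2 \<le> (Re z)\<^sup>2"
    unfolding c2[symmetric] by (simp add: power_mult_distrib mult.assoc)
  then show "cos ?\<theta> * norm z \<le> Re z" by (rule power2_le_imp_le) (use Re in simp)
qed (use p wedge_angle_bounds in auto)

lemma g_nonneg:
  assumes "z \<in> wedge" "norm z \<le> R"
  shows "0 \<le> g z"
proof -
  have z0: "0 < norm z" using assms by (auto simp: wedge_def)
  have "(norm z)\<^sup>2 = norm z powr (2 - p) * norm z powr p"
    using z0 by (simp flip: powr_add powr_numeral)
  also have "\<dots> \<le> R powr (2 - p) * norm z powr p"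
    using assms z0 p_less_2 by (intro mult_right_mono powr_mono2) auto
  also have "\<dots> \<le> A * \<kappa> * norm z powr p" by (simp add: A_times)
  also have "\<dots> \<le> A * Re (z powr of_real p)"
    using Re_powr_wedge[OF assms(1)] A_pos by simp
  finally show ?thesis by (simp add: g_def)
qed

text \<open>Halving the radius costs less than the factor \<open>2\<^sup>2\<close>, which the factor \<open>8\<close> in \<open>A\<close> covers. So the barrier can be
  below the cap only on the disc of radius \<open>R / 2\<close>, where short increments do not leave the disc of radius \<open>R\<close>.\<close>

lemma g_ge_cap:
  assumes "z \<in> wedge" "norm z \<le> R" "R / 2 \<le> norm z"
  shows "R\<^sup>2 \<le> g z"
proof -
  have "2 powr p \<le> 2 powr 2" using p_less_2 by (intro powr_mono) auto
  then have "2 powr p \<le> (4::real)" by simp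
  then have "2 * R\<^sup>2 \<le> 8 * R\<^sup>2 / 2 powr p" using R_bounds by (simp add: field_simps)
  also have "\<dots> = 8 * R powr (2 - p) * (R / 2) powr p"
    using R_bounds by (simp add: powr_divide powr_diff)
  also have "\<dots> \<le> A * \<kappa> * norm z powr p"
    unfolding A_times using assms p R_bounds by (intro mult_left_mono powr_mono2) auto
  also have "\<dots> \<le> A * Re (z powr of_real p)"
    using Re_powr_wedge[OF assms(1)] A_pos by simp
  finally have "2 * R\<^sup>2 \<le> A * Re (z powr of_real p)" .
  moreover have "(norm z)\<^sup>2 \<le> R\<^sup>2" using assms by (intro power_mono) auto
  ultimately show ?thesis by (simp add: g_def)
qed

text \<open>Slack in the shifted quadrant: a ball of radius \<open>e / a\<close> around each of its points is still inside the
  wedge, and twice that radius is a lower bound for the real part, as Taylor's theorem requires.\<close>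

lemma point_wedge:
  assumes "0 < x" "0 < y" "0 < e" "norm w \<le> e / a"
  shows "point e x y + w \<in> wedge" "2 * (e / a) \<le> Re (point e x y)"
proof -
  show Re: "2 * (e / a) \<le> Re (point e x y)"
    using assms a_pos by (simp add: point_def field_simps)
  have w: "\<bar>Re w\<bar> \<le> e / a" "\<bar>Im w\<bar> \<le> e / a"
    using assms(4) abs_Re_le_cmod[of w] abs_Im_le_cmod[of w] by linarith+
  have "b * \<bar>Im (point e x y + w)\<bar> \<le> b * (\<bar>(x - y) / b\<bar> + \<bar>Im w\<bar>)"
    using b_pos abs_triangle_ineq[of "(x - y) / b" "Im w"] by (intro mult_left_mono) (auto simp: point_def)
  also have "\<dots> \<le> \<bar>x - y\<bar> + b * (e / a)"
    using b_pos mult_left_mono[OF w(2), of b] by (simp add: algebra_simps abs_divide)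
  also have "\<dots> \<le> \<bar>x - y\<bar> + e"
    using mult_right_mono[OF b_le_a, of "e / a"] a_pos assms by simp
  also have "\<dots> \<le> x + y + e" using assms by auto
  also have "\<dots> \<le> x + y + 2 * e + a * Re w"
    using mult_left_mono[of "- Re w" "e / a" a] w a_pos by (simp add: abs_le_iff)
  also have "\<dots> = a * Re (point e x y + w)" using a_pos by (simp add: point_def field_simps)
  finally have "b * \<bar>Im (point e x y + w)\<bar> \<le> a * Re (point e x y + w)" .
  moreover have "0 < Re (point e x y) + Re w"
    using Re w divide_pos_pos[OF assms(3) a_pos] by linarith
  then have "0 < Re (point e x y + w)" by simp
  ultimately show "point e x y + w \<in> wedge" by (simp add: wedge_def)
qed

lemma point_in_wedge: "0 < x \<Longrightarrow> 0 < y \<Longrightarrow> 0 < e \<Longrightarrow> point e x y \<in> wedge"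
  using point_wedge(1)[of x y e 0] a_pos by simp

lemma barrier_nonneg: "0 < e \<Longrightarrow> 0 \<le> barrier e x y"
  using g_nonneg[OF point_in_wedge] by (auto simp: barrier_def)

lemma barrier_le_cap: "barrier e x y \<le> R\<^sup>2"
  by (auto simp: barrier_def)

lemma barrier_le_powr:
  assumes "0 < x" "0 < y" "0 < e"
  shows "barrier e x y \<le> A * norm (point e x y) powr p"
proof (cases "norm (point e x y) \<le> R")
  case True
  have "Re (point e x y powr of_real p) \<le> norm (point e x y) powr p"
    using complex_Re_le_cmod[of "point e x y powr of_real p"] point_in_wedge[OF assms]
    by (simp add: norm_powr_of_real wedge_def)
  then have "g (point e x y) \<le> A * norm (point e x y) powr p"
    using A_pos zero_le_power2[of "norm (point e x y)"] unfolding g_def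
    by (smt (verit) mult_left_mono)
  then show ?thesis using True assms by (auto simp: barrier_def)
next
  case False
  have "R\<^sup>2 \<le> 8 * R\<^sup>2" by simp
  also have "\<dots> = A * \<kappa> * R powr p" using R_bounds by (simp add: A_times flip: powr_add)
  also have "\<dots> \<le> A * 1 * norm (point e x y) powr p"
    using False R_bounds p A_pos \<kappa>_bounds by (intro mult_mono powr_mono2) auto
  finally show ?thesis using False assms by (simp add: barrier_def)
qed


text \<open>The second order Taylor polynomial of \<open>g\<close> at \<open>z\<close> in the direction \<open>X + \<i>Y\<close>. The coefficients of
  \<open>X\<^sup>2\<close> and \<open>Y\<^sup>2\<close> add up to \<open>- 2\<close>, since \<open>Re (z\<^sup>p)\<close> is harmonic.\<close>

definition Taylor2 :: "complex \<Rightarrow> real \<Rightarrow> real \<Rightarrow> real" where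
  "Taylor2 z X Y = g z + (A * p * Re (z powr of_real (p - 1)) - 2 * Re z) * X
     + (- A * p * Im (z powr of_real (p - 1)) - 2 * Im z) * Y
     + (A * p * (p - 1) / 2 * Re (z powr of_real (p - 2)) - 1) * X\<^sup>2
     + (- A * p * (p - 1) * Im (z powr of_real (p - 2))) * X * Y
     + (- (A * p * (p - 1) / 2 * Re (z powr of_real (p - 2))) - 1) * Y\<^sup>2"

lemma g_le_Taylor2:
  assumes "0 < r" "2 * r \<le> Re z" "norm w \<le> r"
  shows "g (z + w) \<le> Taylor2 z (Re w) (Im w) + A * r powr (p - 3) * norm w ^ 3"
proof -
  let ?T = "z powr of_real p + p * z powr of_real (p - 1) * w
          + p * (p - 1) / 2 * z powr of_real (p - 2) * w\<^sup>2"
  have "Re ((z + w) powr of_real p - ?T) \<le> r powr (p - 3) * norm w ^ 3"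
    using powr_Taylor2_bound[OF p(1) p_less_2 assms] complex_Re_le_cmod order_trans by blast
  then have "Re ((z + w) powr of_real p) \<le> Re ?T + r powr (p - 3) * norm w ^ 3" by simp
  then have "A * Re ((z + w) powr of_real p) \<le> A * (Re ?T + r powr (p - 3) * norm w ^ 3)"
    using A_pos by simp
  moreover have "A * Re ?T - (norm (z + w))\<^sup>2 = Taylor2 z (Re w) (Im w)"
  proof -
    define u where "u = z powr of_real (p - 1)"
    define v where "v = z powr of_real (p - 2)"
    have "?T = z powr of_real p + of_real p * (u * w) + of_real (p * (p - 1) / 2) * (v * (w * w))"
      by (simp add: u_def v_def power2_eq_square mult.assoc)
    then have "Re ?T = Re (z powr of_real p) + p * (Re u * Re w - Im u * Im w)
        + p * (p - 1) / 2 * (Re v * (Re w * Re w - Im w * Im w) - Im v * (2 * Re w * Im w))"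
      by (simp only: plus_complex.sel Re_complex_of_real Im_complex_of_real times_complex.sel) simp
    then show ?thesis
      unfolding Taylor2_def g_def cmod_power2 u_def[symmetric] v_def[symmetric]
      by (simp only: plus_complex.sel) (simp add: power2_eq_square field_simps)
  qed
  ultimately show ?thesis by (simp add: g_def algebra_simps)
qed

text \<open>Bounds the harmonic part of the second derivatives at distance at least \<open>e / a\<close> from the apex.\<close>

definition hess_bound :: "real \<Rightarrow> real" where "hess_bound e = A * (e / a) powr (p - 2)"

text \<open>The first bound, drift times gradient, must not depend on \<open>e\<close> and dictates the choice of \<open>R\<close>. The
  others only enter error terms, which a small time step defeats for each fixed \<open>e\<close>.\<close>

lemma coefficient_bounds:
  fixes e z assumes e: "0 < e" "2 * (e / a) \<le> Re z" "norm z \<le> R"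
  shows "\<bar>A * p * Re (z powr of_real (p - 1)) - 2 * Re z\<bar> * \<bar>m\<bar> \<le> 1"
    and "\<bar>A * p * Re (z powr of_real (p - 1)) - 2 * Re z\<bar> \<le> 2 * A + 2"
    and "\<bar>- A * p * Im (z powr of_real (p - 1)) - 2 * Im z\<bar> \<le> 2 * A + 2"
    and "\<bar>A * p * (p - 1) / 2 * Re (z powr of_real (p - 2))\<bar> \<le> hess_bound e"
    and "\<bar>A * p * (p - 1) * Im (z powr of_real (p - 2))\<bar> \<le> 2 * hess_bound e"
proof -
  have ea: "0 < e / a" using e a_pos by simp
  have z: "0 < Re z" "0 < norm z" "e / a \<le> norm z"
    using e ea complex_Re_le_cmod[of z] by linarith+
  have pp: "p * (p - 1) \<le> 2 * 1" using p p_less_2 by (intro mult_mono) auto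
  have "norm (z powr of_real (p - 1)) = norm z powr (p - 1)" by (rule norm_powr_of_real) (rule z)
  also have "\<dots> \<le> R powr (p - 1)" using e z p by (intro powr_mono2) auto
  finally have n1: "norm (z powr of_real (p - 1)) \<le> R powr (p - 1)" .
  have R1: "R powr (p - 1) \<le> 1"
    using R_bounds p by (intro powr_le1) auto
  have Re1: "\<bar>Re (z powr of_real (p - 1))\<bar> \<le> R powr (p - 1)"
    and Im1: "\<bar>Im (z powr of_real (p - 1))\<bar> \<le> R powr (p - 1)"
    using n1 abs_Re_le_cmod abs_Im_le_cmod order_trans by blast+
  have Rez: "\<bar>Re z\<bar> \<le> R" and Imz: "\<bar>Im z\<bar> \<le> R"
    using e abs_Re_le_cmod abs_Im_le_cmod order_trans by blast+
  have "A * R powr (p - 1) = 8 * R / \<kappa>"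
    using R_bounds by (simp add: A_def flip: powr_add)
  have *: "\<bar>A * p * u\<bar> \<le> A * 2 * R powr (p - 1)" if "\<bar>u\<bar> \<le> R powr (p - 1)" for u
    using that A_pos p p_less_2 unfolding abs_mult by (intro mult_mono) auto
  have "\<bar>A * p * Re (z powr of_real (p - 1)) - 2 * Re z\<bar> \<le> A * 2 * R powr (p - 1) + 2 * R"
    using *[OF Re1] Rez by linarith
  also have "\<dots> = (16 / \<kappa> + 2) * R"
    using \<open>A * R powr (p - 1) = _\<close> by (simp add: algebra_simps)
  finally have "\<bar>A * p * Re (z powr of_real (p - 1)) - 2 * Re z\<bar> * \<bar>m\<bar>
      \<le> (16 / \<kappa> + 2) * R * \<bar>m\<bar>" by (rule mult_right_mono) simp
  also have "\<dots> \<le> 1" using R_bounds by (simp add: mult_ac)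
  finally show "\<bar>A * p * Re (z powr of_real (p - 1)) - 2 * Re z\<bar> * \<bar>m\<bar> \<le> 1" .
  have A2: "A * 2 * R powr (p - 1) \<le> 2 * A" using R1 A_pos by simp
  show "\<bar>A * p * Re (z powr of_real (p - 1)) - 2 * Re z\<bar> \<le> 2 * A + 2"
    "\<bar>- A * p * Im (z powr of_real (p - 1)) - 2 * Im z\<bar> \<le> 2 * A + 2"
    using *[OF Re1] *[OF Im1] Rez Imz A2 R_bounds by linarith+
  have "norm (z powr of_real (p - 2)) = norm z powr (p - 2)" by (rule norm_powr_of_real) (rule z)
  also have "\<dots> \<le> (e / a) powr (p - 2)" using z ea p_less_2 by (intro powr_mono2') auto
  finally have n2: "norm (z powr of_real (p - 2)) \<le> (e / a) powr (p - 2)" .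
  have Re2: "\<bar>Re (z powr of_real (p - 2))\<bar> \<le> (e / a) powr (p - 2)"
    and Im2: "\<bar>Im (z powr of_real (p - 2))\<bar> \<le> (e / a) powr (p - 2)"
    using n2 abs_Re_le_cmod abs_Im_le_cmod order_trans by blast+
  have **: "\<bar>A * (p * (p - 1)) * u\<bar> \<le> A * 2 * (e / a) powr (p - 2)"
    if "\<bar>u\<bar> \<le> (e / a) powr (p - 2)" for u
    using that A_pos p pp unfolding abs_mult by (intro mult_mono) auto
  show "\<bar>A * p * (p - 1) / 2 * Re (z powr of_real (p - 2))\<bar> \<le> hess_bound e"
    "\<bar>A * p * (p - 1) * Im (z powr of_real (p - 2))\<bar> \<le> 2 * hess_bound e"
    using **[OF Re2] **[OF Im2] by (simp_all add: hess_bound_def abs_mult mult_ac)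
qed

lemma barrier_below_capD:
  assumes "0 < x" "0 < y" "0 < e" "barrier e x y < R\<^sup>2"
  shows "norm (point e x y) < R / 2" "barrier e x y = g (point e x y)"
proof -
  show n: "norm (point e x y) < R / 2"
  proof (rule ccontr)
    assume "\<not> ?thesis"
    then show False
      using assms g_ge_cap[OF point_in_wedge[OF assms(1-3)]]
      by (auto simp: barrier_def split: if_splits)
  qed
  have "norm (point e x y) \<le> R" using n R_bounds by linarith
  then show "barrier e x y = g (point e x y)"
    using assms by (auto simp: barrier_def min_def split: if_splits)
qed

text \<open>For short increments this is Taylor's theorem, the barrier lying below \<open>g\<close> as long as \<open>g\<close> is nonnegative.
  For increments longer than \<open>\<eta>\<close> everything is bounded by a quadratic polynomial in \<open>\<bar>w\<bar>\<close>, which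
  \<open>\<bar>w\<bar>\<^sup>3\<close> dominates up to a power of \<open>\<eta>\<close>; so large jumps cost no separate tail estimate. The constant
  depends on \<open>e\<close> only.\<close>

lemma barrier_le_Taylor2:
  assumes e: "0 < e"
  shows "\<exists>C\<ge>0. \<forall>x y x' y' w. 0 < x \<longrightarrow> 0 < y \<longrightarrow> barrier e x y < R\<^sup>2 \<longrightarrow>
           point e x' y' = point e x y + w \<longrightarrow>
           barrier e x' y' \<le> Taylor2 (point e x y) (Re w) (Im w) + C * norm w ^ 3"
proof -
  define r where "r = e / a"
  define \<eta> where "\<eta> = min (R / 2) r"
  define C1 where "C1 = A * r powr (p - 3)"
  define C2 where "C2 = 1 / \<eta> ^ 3 + (4 * A + 4) / \<eta>\<^sup>2 + (4 * hess_bound e + 2) / \<eta>"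
  have r: "0 < r" using e a_pos by (simp add: r_def)
  have \<eta>: "0 < \<eta>" "\<eta> \<le> R / 2" "\<eta> \<le> r" using r R_bounds by (auto simp: \<eta>_def)
  have h0: "0 \<le> hess_bound e" using A_pos by (simp add: hess_bound_def)
  have C: "0 \<le> C1" "0 \<le> C2" using A_pos \<eta> h0 by (auto simp: C1_def C2_def)
  have "barrier e x' y' \<le> Taylor2 (point e x y) (Re w) (Im w) + (C1 + C2) * norm w ^ 3"
    if xy: "0 < x" "0 < y" and lt: "barrier e x y < R\<^sup>2" and pt: "point e x' y' = point e x y + w"
    for x y x' y' w
  proof -
    define z where "z = point e x y"
    note D = barrier_below_capD[OF xy e lt, folded z_def]
    have Rez: "2 * r \<le> Re z" unfolding r_def z_def using xy e a_pos by (intro point_wedge(2)[where w = 0]) auto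
    show ?thesis
    proof (cases "norm w \<le> \<eta>")
      case True
      have "norm (z + w) \<le> R" using True \<eta> D norm_triangle_ineq[of z w] by linarith
      moreover have "z + w \<in> wedge"
        unfolding z_def using xy e True \<eta> by (intro point_wedge(1)) (auto simp: r_def)
      ultimately have "0 \<le> g (z + w)" "norm (z + w) \<le> R" by (auto intro: g_nonneg)
      then have "barrier e x' y' \<le> g (z + w)" by (auto simp: barrier_def pt z_def)
      also have "\<dots> \<le> Taylor2 z (Re w) (Im w) + C1 * norm w ^ 3"
        unfolding C1_def using r Rez True \<eta> by (intro g_le_Taylor2) auto
      also have "\<dots> \<le> Taylor2 z (Re w) (Im w) + (C1 + C2) * norm w ^ 3"
        using C by (simp add: mult_right_mono)
      finally show ?thesis by (simp add: z_def)
    next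
      case False
      define n where "n = norm w"
      have n: "\<eta> < n" "0 < n" using False \<eta> by (auto simp: n_def)
      have X: "\<bar>Re w\<bar> \<le> n" and Y: "\<bar>Im w\<bar> \<le> n" by (auto simp: n_def abs_Re_le_cmod abs_Im_le_cmod)
      have zR: "norm z \<le> R" using D R_bounds by linarith
      note cb = coefficient_bounds(2-5)[OF e Rez[unfolded r_def] zR]
      have g0: "0 \<le> g z" using D barrier_nonneg[OF e, of x y] by simp
      have sq: "(Re w)\<^sup>2 \<le> n\<^sup>2" "(Im w)\<^sup>2 \<le> n\<^sup>2" "\<bar>Re w * Im w\<bar> \<le> n\<^sup>2"
        using X Y power_mono[OF X, of 2] power_mono[OF Y, of 2] mult_mono[OF X Y]
        by (auto simp: abs_mult power2_eq_square)
      then have sq': "\<bar>(Re w)\<^sup>2\<bar> \<le> n\<^sup>2" "\<bar>(Im w)\<^sup>2\<bar> \<le> n\<^sup>2" "\<bar>Re w * Im w\<bar> \<le> n\<^sup>2" by auto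
      have cbs: "\<bar>A * p * (p - 1) / 2 * Re (z powr of_real (p - 2)) - 1\<bar> \<le> hess_bound e + 1"
        "\<bar>- A * p * (p - 1) * Im (z powr of_real (p - 2))\<bar> \<le> 2 * hess_bound e"
        "\<bar>- (A * p * (p - 1) / 2 * Re (z powr of_real (p - 2))) - 1\<bar> \<le> hess_bound e + 1"
        using cb(3,4) by (simp_all only: mult_minus_left abs_minus_cancel)
      have bnd: "- (k * q) \<le> u * v" if "\<bar>u\<bar> \<le> k" "\<bar>v\<bar> \<le> q" for u v k q :: real
      proof -
        have "\<bar>u * v\<bar> \<le> k * q" unfolding abs_mult using that by (intro mult_mono) auto
        then show ?thesis by linarith
      qed
      have "- ((2 * A + 2) * n) \<le> (A * p * Re (z powr of_real (p - 1)) - 2 * Re z) * Re w"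
        "- ((2 * A + 2) * n) \<le> (- A * p * Im (z powr of_real (p - 1)) - 2 * Im z) * Im w"
        "- ((hess_bound e + 1) * n\<^sup>2) \<le> (A * p * (p - 1) / 2 * Re (z powr of_real (p - 2)) - 1) * (Re w)\<^sup>2"
        "- ((2 * hess_bound e) * n\<^sup>2) \<le> (- A * p * (p - 1) * Im (z powr of_real (p - 2))) * (Re w * Im w)"
        "- ((hess_bound e + 1) * n\<^sup>2) \<le> (- (A * p * (p - 1) / 2 * Re (z powr of_real (p - 2))) - 1) * (Im w)\<^sup>2"
        by (rule bnd[OF cb(1) X] bnd[OF cb(2) Y] bnd[OF cbs(1) sq'(1)] bnd[OF cbs(2) sq'(3)]
            bnd[OF cbs(3) sq'(2)])+
      then have "- (Taylor2 z (Re w) (Im w)) \<le> (4 * A + 4) * n + (4 * hess_bound e + 2) * n\<^sup>2"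
      proof -
        have "(4 * A + 4) * n + (4 * hess_bound e + 2) * n\<^sup>2 = (2 * A + 2) * n + (2 * A + 2) * n
            + (hess_bound e + 1) * n\<^sup>2 + 2 * hess_bound e * n\<^sup>2 + (hess_bound e + 1) * n\<^sup>2"
          by (simp add: algebra_simps)
        moreover assume "- ((2 * A + 2) * n) \<le> (A * p * Re (z powr of_real (p - 1)) - 2 * Re z) * Re w"
          "- ((2 * A + 2) * n) \<le> (- A * p * Im (z powr of_real (p - 1)) - 2 * Im z) * Im w"
          "- ((hess_bound e + 1) * n\<^sup>2) \<le> (A * p * (p - 1) / 2 * Re (z powr of_real (p - 2)) - 1) * (Re w)\<^sup>2"
          "- ((2 * hess_bound e) * n\<^sup>2) \<le> (- A * p * (p - 1) * Im (z powr of_real (p - 2))) * (Re w * Im w)"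
          "- ((hess_bound e + 1) * n\<^sup>2) \<le> (- (A * p * (p - 1) / 2 * Re (z powr of_real (p - 2))) - 1) * (Im w)\<^sup>2"
        moreover have "- A * p * (p - 1) * Im (z powr of_real (p - 2)) * Re w * Im w
          = (- A * p * (p - 1) * Im (z powr of_real (p - 2))) * (Re w * Im w)" by (simp only: mult.assoc)
        ultimately show ?thesis using g0 unfolding Taylor2_def by linarith
      qed
      moreover have "R\<^sup>2 \<le> 1" using R_bounds by (simp add: power_le_one)
      ultimately have "R\<^sup>2 - Taylor2 z (Re w) (Im w) \<le> 1 + (4 * A + 4) * n + (4 * hess_bound e + 2) * n\<^sup>2"
        by linarith
      also have "\<dots> \<le> C2 * n ^ 3"
      proof -
        have "\<eta> ^ 3 \<le> n ^ 3" "\<eta>\<^sup>2 \<le> n\<^sup>2" using n \<eta> by (auto intro!: power_mono)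
        then have "1 \<le> 1 / \<eta> ^ 3 * n ^ 3" and q: "1 \<le> n\<^sup>2 / \<eta>\<^sup>2" "1 \<le> n / \<eta>"
          using \<eta> n by (auto simp: field_simps)
        moreover have "(4 * A + 4) * n * 1 \<le> (4 * A + 4) * n * (n\<^sup>2 / \<eta>\<^sup>2)"
          using q n A_pos by (intro mult_left_mono) auto
        moreover have "(4 * hess_bound e + 2) * n\<^sup>2 * 1 \<le> (4 * hess_bound e + 2) * n\<^sup>2 * (n / \<eta>)"
          using q n h0 by (intro mult_left_mono) auto
        moreover have "C2 * n ^ 3 = 1 / \<eta> ^ 3 * n ^ 3 + (4 * A + 4) * n * (n\<^sup>2 / \<eta>\<^sup>2)
            + (4 * hess_bound e + 2) * n\<^sup>2 * (n / \<eta>)"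
          unfolding C2_def by (simp add: power2_eq_square power3_eq_cube ring_distribs mult_ac add_divide_distrib)
        ultimately show ?thesis by linarith
      qed
      also have "\<dots> \<le> (C1 + C2) * n ^ 3" using C n by (intro mult_right_mono) auto
      finally show ?thesis using barrier_le_cap[of e x' y'] by (simp add: z_def n_def)
    qed
  qed
  then show ?thesis using C by (intro exI[of _ "C1 + C2"]) auto
qed


lemma point_step:
  "point e (x - \<mu> * \<delta> - \<sigma>M * h * G0 - \<sigma>I * h * G1) (y - \<mu> * \<delta> - \<sigma>M * h * G0 - \<sigma>I * h * G2)
     = point e x y + Complex (m * \<delta> - h * (2 * \<sigma>M / a * G0 + \<sigma>I / a * G1 + \<sigma>I / a * G2))
                             (- (h * (\<sigma>I / b) * (G1 - G2)))"
  using a_pos b_pos by (simp add: point_def m_def complex_eq_iff field_simps)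

lemma step_coefficients:
  "(2 * \<sigma>M / a)\<^sup>2 + 2 * (\<sigma>I / a)\<^sup>2 = 1" "2 * (\<sigma>I / b)\<^sup>2 = 1"
  "0 \<le> 2 * \<sigma>M / a" "2 * \<sigma>M / a \<le> 1" "0 \<le> \<sigma>I / a" "\<sigma>I / a \<le> 1" "0 \<le> \<sigma>I / b" "\<sigma>I / b \<le> 1"
proof -
  have "(2 * \<sigma>M)\<^sup>2 + 2 * \<sigma>I\<^sup>2 = a\<^sup>2" by (simp add: a_sq power_mult_distrib)
  moreover have "0 < a\<^sup>2" "0 < b\<^sup>2" using a_pos b_pos by auto
  ultimately show 1: "(2 * \<sigma>M / a)\<^sup>2 + 2 * (\<sigma>I / a)\<^sup>2 = 1" and 2: "2 * (\<sigma>I / b)\<^sup>2 = 1"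
    using b_sq by (simp_all add: power_divide add_divide_distrib[symmetric])
  show 3: "0 \<le> 2 * \<sigma>M / a" "0 \<le> \<sigma>I / a" "0 \<le> \<sigma>I / b" using \<sigma>M \<sigma>I a_pos b_pos by auto
  have "(2 * \<sigma>M / a)\<^sup>2 \<le> 1\<^sup>2" "(\<sigma>I / a)\<^sup>2 \<le> 1\<^sup>2" "(\<sigma>I / b)\<^sup>2 \<le> 1\<^sup>2"
    using 1 2 zero_le_power2[of "2 * \<sigma>M / a"] zero_le_power2[of "\<sigma>I / a"] zero_le_power2[of "\<sigma>I / b"]
    unfolding one_power2 by linarith+
  then show "2 * \<sigma>M / a \<le> 1" "\<sigma>I / a \<le> 1" "\<sigma>I / b \<le> 1"
    using power2_le_imp_le[of _ 1] by auto
qed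

lemma norm_step_cubed:
  assumes \<delta>: "0 < \<delta>" "\<delta> \<le> 1"
  shows "norm (Complex (m * \<delta> - sqrt \<delta> * (2 * \<sigma>M / a * G0 + \<sigma>I / a * G1 + \<sigma>I / a * G2))
                   (- (sqrt \<delta> * (\<sigma>I / b) * (G1 - G2)))) ^ 3
    \<le> \<delta> * sqrt \<delta> * (16 * (\<bar>m\<bar> + 2) ^ 3) * (1 + (\<bar>G0\<bar> ^ 3 + \<bar>G1\<bar> ^ 3 + \<bar>G2\<bar> ^ 3))"
    (is "norm ?w ^ 3 \<le> _")
proof -
  note sc = step_coefficients
  define s where "s = 1 + \<bar>G0\<bar> + \<bar>G1\<bar> + \<bar>G2\<bar>"
  have h: "0 < sqrt \<delta>" "sqrt \<delta> \<le> 1" using \<delta> by auto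
  have dl: "\<delta> \<le> sqrt \<delta>" using h \<delta> mult_left_mono[of "sqrt \<delta>" 1 "sqrt \<delta>"] by simp
  have k: "\<bar>c * G\<bar> \<le> \<bar>G\<bar>" if "0 \<le> c" "c \<le> 1" for c G :: real
    using that by (simp add: abs_mult mult_left_le_one_le)
  have X: "\<bar>m * \<delta> - sqrt \<delta> * (2 * \<sigma>M / a * G0 + \<sigma>I / a * G1 + \<sigma>I / a * G2)\<bar>
     \<le> \<bar>m\<bar> * sqrt \<delta> + sqrt \<delta> * (\<bar>G0\<bar> + \<bar>G1\<bar> + \<bar>G2\<bar>)"
  proof -
    have "\<bar>m * \<delta>\<bar> \<le> \<bar>m\<bar> * sqrt \<delta>" using dl \<delta> by (simp add: abs_mult mult_left_mono)
    moreover have "\<bar>2 * \<sigma>M / a * G0 + \<sigma>I / a * G1 + \<sigma>I / a * G2\<bar> \<le> \<bar>G0\<bar> + \<bar>G1\<bar> + \<bar>G2\<bar>"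
      using k[OF sc(3,4), of G0] k[OF sc(5,6), of G1] k[OF sc(5,6), of G2] by linarith
    then have "\<bar>sqrt \<delta> * (2 * \<sigma>M / a * G0 + \<sigma>I / a * G1 + \<sigma>I / a * G2)\<bar>
        \<le> sqrt \<delta> * (\<bar>G0\<bar> + \<bar>G1\<bar> + \<bar>G2\<bar>)"
      using h by (simp add: abs_mult mult_left_mono del: mult_le_cancel_left_pos)
    ultimately show ?thesis by linarith
  qed
  have Y: "\<bar>- (sqrt \<delta> * (\<sigma>I / b) * (G1 - G2))\<bar> \<le> sqrt \<delta> * (\<bar>G1\<bar> + \<bar>G2\<bar>)"
  proof -
    have "\<bar>\<sigma>I / b * (G1 - G2)\<bar> \<le> \<bar>G1\<bar> + \<bar>G2\<bar>" using k[OF sc(7,8), of "G1 - G2"] by linarith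
    then have "sqrt \<delta> * \<bar>\<sigma>I / b * (G1 - G2)\<bar> \<le> sqrt \<delta> * (\<bar>G1\<bar> + \<bar>G2\<bar>)"
      using h by (intro mult_left_mono) auto
    then show ?thesis using h by (simp only: abs_minus_cancel mult.assoc abs_mult[of "sqrt \<delta>"] abs_of_pos)
  qed
  have "norm ?w \<le> \<bar>m\<bar> * sqrt \<delta> + sqrt \<delta> * (\<bar>G0\<bar> + \<bar>G1\<bar> + \<bar>G2\<bar>) + sqrt \<delta> * (\<bar>G1\<bar> + \<bar>G2\<bar>)"
    using cmod_le[of ?w] X Y by simp
  also have "\<dots> = sqrt \<delta> * (\<bar>m\<bar> + (\<bar>G0\<bar> + 2 * \<bar>G1\<bar> + 2 * \<bar>G2\<bar>))" by (simp add: algebra_simps)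
  also have "\<dots> \<le> sqrt \<delta> * ((\<bar>m\<bar> + 2) * s)"
  proof (intro mult_left_mono)
    have "\<bar>m\<bar> * 1 \<le> \<bar>m\<bar> * s" by (intro mult_left_mono) (auto simp: s_def)
    then show "\<bar>m\<bar> + (\<bar>G0\<bar> + 2 * \<bar>G1\<bar> + 2 * \<bar>G2\<bar>) \<le> (\<bar>m\<bar> + 2) * s"
      by (simp add: s_def algebra_simps)
  qed (use h in auto)
  finally have "norm ?w ^ 3 \<le> (sqrt \<delta> * ((\<bar>m\<bar> + 2) * s)) ^ 3" by (intro power_mono) auto
  also have "\<dots> = \<delta> * sqrt \<delta> * (\<bar>m\<bar> + 2) ^ 3 * s ^ 3"
    using \<delta> by (simp add: power_mult_distrib power3_eq_cube)
  also have "\<dots> \<le> \<delta> * sqrt \<delta> * (\<bar>m\<bar> + 2) ^ 3 * (16 * (1 + (\<bar>G0\<bar> ^ 3 + \<bar>G1\<bar> ^ 3 + \<bar>G2\<bar> ^ 3)))"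
    unfolding s_def using \<delta> by (intro mult_left_mono cube_sum4_le) auto
  also have "\<dots> = \<delta> * sqrt \<delta> * (16 * (\<bar>m\<bar> + 2) ^ 3) * (1 + (\<bar>G0\<bar> ^ 3 + \<bar>G1\<bar> ^ 3 + \<bar>G2\<bar> ^ 3))"
    by (simp only: mult_ac)
  finally show ?thesis .
qed

text \<open>One Gaussian step of length \<open>\<delta>\<close> followed by killing decreases the barrier by \<open>\<delta> / 2\<close>, up to the
  growth factor. Below the cap the expected Taylor polynomial is at most \<open>g z - \<delta>\<close> plus terms of order
  \<open>\<delta>\<^bsup>3/2\<^esup>\<close>. On the cap, where the barrier is maximal, the growth factor \<open>1 + \<delta> / (2 R\<^sup>2)\<close> exactly pays for
  the decrease. The scalar \<open>k\<close> is carried along for use inside the iteration; the first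
  conclusion keeps the right-hand side meaningful as an extended nonnegative real.\<close>

lemma barrier_step:
  assumes e: "0 < e"
  shows "\<exists>\<delta>0>0. \<forall>\<delta> x y k. 0 < \<delta> \<longrightarrow> \<delta> \<le> \<delta>0 \<longrightarrow> 0 < x \<longrightarrow> 0 < y \<longrightarrow> 0 \<le> k \<longrightarrow>
     0 \<le> (1 + \<delta> / (2 * R\<^sup>2)) * barrier e x y - \<delta> / 2 \<and>
     (\<integral>\<^sup>+G0. \<integral>\<^sup>+G1. \<integral>\<^sup>+G2. ennreal (k * barrier e
           (x - \<mu> * \<delta> - \<sigma>M * sqrt \<delta> * G0 - \<sigma>I * sqrt \<delta> * G1)
           (y - \<mu> * \<delta> - \<sigma>M * sqrt \<delta> * G0 - \<sigma>I * sqrt \<delta> * G2))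
       \<partial>std_normal_distribution \<partial>std_normal_distribution \<partial>std_normal_distribution)
     \<le> ennreal (k * ((1 + \<delta> / (2 * R\<^sup>2)) * barrier e x y - \<delta> / 2))"
proof -
  obtain C where C: "0 \<le> C" and up: "\<And>x y x' y' w. \<lbrakk>0 < x; 0 < y; barrier e x y < R\<^sup>2;
      point e x' y' = point e x y + w\<rbrakk> \<Longrightarrow>
      barrier e x' y' \<le> Taylor2 (point e x y) (Re w) (Im w) + C * norm w ^ 3"
    using barrier_le_Taylor2[OF e] by metis
  let ?m3 = "std_normal_abs_moment3"
  define D where "D = hess_bound e * m\<^sup>2 + C * (16 * (\<bar>m\<bar> + 2) ^ 3) * (1 + 3 * ?m3)"
  have h0: "0 \<le> hess_bound e" using A_pos by (simp add: hess_bound_def)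
  have D: "0 \<le> D" unfolding D_def using C h0 std_normal_abs_moment3_nonneg by auto
  define \<delta>0 where "\<delta>0 = (1 / (2 * (1 + D)))\<^sup>2"
  show ?thesis
  proof (intro exI[of _ \<delta>0] conjI allI impI)
    \<comment> \<open>with this step size the error, at most \<open>D \<delta> sqrt \<delta>\<close>, takes at most half of the decrease \<open>\<delta>\<close>\<close>
    show "0 < \<delta>0" using D by (simp add: \<delta>0_def)
    fix \<delta> x y k :: real
    assume \<delta>: "0 < \<delta>" "\<delta> \<le> \<delta>0" and xy: "0 < x" "0 < y" and k: "0 \<le> k"
    have "sqrt \<delta> \<le> sqrt \<delta>0" using \<delta> by simp
    then have sd: "sqrt \<delta> \<le> 1 / (2 * (1 + D))" using D by (simp add: \<delta>0_def)
    have "1 / (2 * (1 + D)) \<le> 1" using D by simp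
    then have sd1: "sqrt \<delta> \<le> 1" using sd by linarith
    then have d1: "\<delta> \<le> 1" by simp
    have dl: "\<delta> \<le> sqrt \<delta>" using sd1 \<delta> mult_left_mono[of "sqrt \<delta>" 1 "sqrt \<delta>"] by simp
    have Dsd: "D * sqrt \<delta> \<le> 1 / 2"
    proof -
      have "D * sqrt \<delta> \<le> D * (1 / (2 * (1 + D)))" using sd D by (rule mult_left_mono)
      also have "\<dots> \<le> 1 / 2" using D by (simp add: field_simps)
      finally show ?thesis .
    qed
    let ?f = "barrier e x y"
    let ?F = "\<lambda>G0 G1 G2. barrier e (x - \<mu> * \<delta> - \<sigma>M * sqrt \<delta> * G0 - \<sigma>I * sqrt \<delta> * G1)
           (y - \<mu> * \<delta> - \<sigma>M * sqrt \<delta> * G0 - \<sigma>I * sqrt \<delta> * G2)"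
    let ?I = "\<integral>\<^sup>+G0. \<integral>\<^sup>+G1. \<integral>\<^sup>+G2. ennreal (k * ?F G0 G1 G2)
       \<partial>std_normal_distribution \<partial>std_normal_distribution \<partial>std_normal_distribution"
    have R2: "0 < R\<^sup>2" using R_bounds by simp
    interpret N: prob_space std_normal_distribution by (rule prob_space_normal_density) simp
    have "0 \<le> (1 + \<delta> / (2 * R\<^sup>2)) * ?f - \<delta> / 2 \<and> ?I \<le> ennreal (k * ((1 + \<delta> / (2 * R\<^sup>2)) * ?f - \<delta> / 2))"
    proof (cases "?f < R\<^sup>2")
      case False
      then have f: "?f = R\<^sup>2" using barrier_le_cap[of e x y] by linarith
      have "?I \<le> (\<integral>\<^sup>+G0. \<integral>\<^sup>+G1. \<integral>\<^sup>+G2. ennreal (k * R\<^sup>2)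
         \<partial>std_normal_distribution \<partial>std_normal_distribution \<partial>std_normal_distribution)"
        by (intro nn_integral_mono ennreal_leI mult_left_mono barrier_le_cap k)
      also have "\<dots> = ennreal (k * R\<^sup>2)" using N.emeasure_space_1 by simp
      also have "k * R\<^sup>2 = k * ((1 + \<delta> / (2 * R\<^sup>2)) * ?f - \<delta> / 2)"
        unfolding f using R2 by (simp add: field_simps)
      finally have "?I \<le> ennreal (k * ((1 + \<delta> / (2 * R\<^sup>2)) * ?f - \<delta> / 2))" .
      moreover have "(1 + \<delta> / (2 * R\<^sup>2)) * R\<^sup>2 - \<delta> / 2 = R\<^sup>2" using R2 by (simp add: field_simps)
      ultimately show ?thesis using R2 unfolding f by auto
    next
      case True
      define z where "z = point e x y"
      note Bd = barrier_below_capD[OF xy e True, folded z_def]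
      have Rez: "2 * (e / a) \<le> Re z"
        unfolding z_def using xy e a_pos by (intro point_wedge(2)[where w = 0]) auto
      have zR: "norm z \<le> R" using Bd R_bounds by linarith
      note cb = coefficient_bounds[OF e Rez zR]
      define L1 L2 H Q12 where "L1 = A * p * Re (z powr of_real (p - 1)) - 2 * Re z"
        and "L2 = - A * p * Im (z powr of_real (p - 1)) - 2 * Im z"
        and "H = A * p * (p - 1) / 2 * Re (z powr of_real (p - 2))"
        and "Q12 = - A * p * (p - 1) * Im (z powr of_real (p - 2))"
      define l where "l = C * (\<delta> * sqrt \<delta> * (16 * (\<bar>m\<bar> + 2) ^ 3))"
      let ?X = "\<lambda>G0 G1 G2. m * \<delta> - sqrt \<delta> * (2 * \<sigma>M / a * G0 + \<sigma>I / a * G1 + \<sigma>I / a * G2)"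
      let ?Y = "\<lambda>G1 G2. - (sqrt \<delta> * (\<sigma>I / b) * (G1 - G2))"
      let ?P = "\<lambda>G0 G1 G2. g z + L1 * ?X G0 G1 G2 + L2 * ?Y G1 G2 + (H - 1) * (?X G0 G1 G2)\<^sup>2
         + Q12 * ?X G0 G1 G2 * ?Y G1 G2 + (- H - 1) * (?Y G1 G2)\<^sup>2
         + l * (1 + (\<bar>G0\<bar> ^ 3 + \<bar>G1\<bar> ^ 3 + \<bar>G2\<bar> ^ 3))"
      have FP: "?F G0 G1 G2 \<le> ?P G0 G1 G2" for G0 G1 G2
      proof -
        let ?w = "Complex (?X G0 G1 G2) (?Y G1 G2)"
        have "?F G0 G1 G2 \<le> Taylor2 z (Re ?w) (Im ?w) + C * norm ?w ^ 3"
          unfolding z_def by (rule up[OF xy True]) (rule point_step)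
        also have "\<dots> \<le> Taylor2 z (Re ?w) (Im ?w)
            + C * (\<delta> * sqrt \<delta> * (16 * (\<bar>m\<bar> + 2) ^ 3) * (1 + (\<bar>G0\<bar> ^ 3 + \<bar>G1\<bar> ^ 3 + \<bar>G2\<bar> ^ 3)))"
          by (intro add_left_mono mult_left_mono norm_step_cubed \<delta> d1 C)
        also have "\<dots> = ?P G0 G1 G2"
          unfolding Taylor2_def L1_def L2_def H_def Q12_def l_def by (simp add: mult.assoc)
        finally show ?thesis .
      qed
      have P0: "0 \<le> ?P G0 G1 G2" for G0 G1 G2
        using FP barrier_nonneg[OF e] order_trans by blast
      let ?V = "g z + L1 * (m * \<delta>) + (H - 1) * ((m * \<delta>)\<^sup>2 + (sqrt \<delta>)\<^sup>2) + (- H - 1) * (sqrt \<delta>)\<^sup>2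
          + l * (1 + 3 * ?m3)"
      note P = nn_integral_std_normal3_quadratic_forms[OF step_coefficients(1,2) P0]
      have V: "?V \<le> (1 + \<delta> / (2 * R\<^sup>2)) * ?f - \<delta> / 2"
      proof -
        have "L1 * m \<le> 1" using cb(1) abs_ge_self[of "L1 * m"] by (simp add: L1_def abs_mult)
        then have "L1 * m * \<delta> \<le> \<delta>" using \<delta> by simp
        moreover have "H * (m * \<delta>)\<^sup>2 \<le> hess_bound e * m\<^sup>2 * (\<delta> * sqrt \<delta>)"
        proof -
          have "H * (m * \<delta>)\<^sup>2 \<le> hess_bound e * (m * \<delta>)\<^sup>2"
            using cb(4) by (intro mult_right_mono) (auto simp: H_def)
          also have "\<dots> = hess_bound e * m\<^sup>2 * (\<delta> * \<delta>)" by (simp add: power2_eq_square)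
          also have "\<dots> \<le> hess_bound e * m\<^sup>2 * (\<delta> * sqrt \<delta>)"
            using dl h0 \<delta> by (intro mult_left_mono) auto
          finally show ?thesis .
        qed
        moreover have "hess_bound e * m\<^sup>2 * (\<delta> * sqrt \<delta>) + l * (1 + 3 * ?m3) = \<delta> * (D * sqrt \<delta>)"
          by (simp add: l_def D_def algebra_simps)
        moreover have "\<delta> * (D * sqrt \<delta>) \<le> \<delta> * (1 / 2)"
          using Dsd \<delta> by (intro mult_left_mono) auto
        moreover have "?V = g z + L1 * m * \<delta> + H * (m * \<delta>)\<^sup>2 - (m * \<delta>)\<^sup>2 - 2 * \<delta> + l * (1 + 3 * ?m3)"
          using \<delta> by (simp add: algebra_simps)
        ultimately have "?V \<le> g z - \<delta> / 2" using zero_le_power2[of "m * \<delta>"] by linarith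
        moreover have "1 * g z \<le> (1 + \<delta> / (2 * R\<^sup>2)) * g z"
          using barrier_nonneg[OF e, of x y] Bd \<delta> by (intro mult_right_mono) auto
        ultimately show ?thesis using Bd by simp
      qed
      have "?I \<le> (\<integral>\<^sup>+G0. \<integral>\<^sup>+G1. \<integral>\<^sup>+G2. ennreal k * ennreal (?P G0 G1 G2)
         \<partial>std_normal_distribution \<partial>std_normal_distribution \<partial>std_normal_distribution)"
        unfolding ennreal_mult[OF k P0, symmetric]
        by (intro nn_integral_mono ennreal_leI mult_left_mono FP k)
      also have "\<dots> = ennreal k * (\<integral>\<^sup>+G0. \<integral>\<^sup>+G1. \<integral>\<^sup>+G2. ennreal (?P G0 G1 G2)
         \<partial>std_normal_distribution \<partial>std_normal_distribution \<partial>std_normal_distribution)"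
        by (simp add: nn_integral_cmult)
      also have "\<dots> = ennreal k * ennreal ?V" unfolding P(1) ..
      also have "\<dots> = ennreal (k * ?V)" using k P(2) by (simp add: ennreal_mult)
      also have "\<dots> \<le> ennreal (k * ((1 + \<delta> / (2 * R\<^sup>2)) * ?f - \<delta> / 2))"
        by (intro ennreal_leI mult_left_mono V k)
      finally show ?thesis using V P(2) by linarith
    qed
    then show "0 \<le> (1 + \<delta> / (2 * R\<^sup>2)) * ?f - \<delta> / 2"
      "?I \<le> ennreal (k * ((1 + \<delta> / (2 * R\<^sup>2)) * ?f - \<delta> / 2))" by blast+
  qed
qed

end

section \<open>Freezing independent variables\<close>

lemma measurable_from_subalg_target:
  assumes "subalgebra M N" "f \<in> L \<rightarrow>\<^sub>M M"
  shows "f \<in> L \<rightarrow>\<^sub>M N"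
  using assms unfolding subalgebra_def measurable_def by auto

lemma measurable_pair_subalgebra:
  assumes "subalgebra M N" "f \<in> borel_measurable (L \<Otimes>\<^sub>M N)"
  shows "f \<in> borel_measurable (L \<Otimes>\<^sub>M M)"
proof -
  have "snd \<in> L \<Otimes>\<^sub>M M \<rightarrow>\<^sub>M N"
    by (rule measurable_from_subalg_target[OF assms(1) measurable_snd])
  then have "(\<lambda>p. (fst p, snd p)) \<in> L \<Otimes>\<^sub>M M \<rightarrow>\<^sub>M L \<Otimes>\<^sub>M N"
    by (intro measurable_Pair measurable_fst)
  from measurable_compose[OF this assms(2)] show ?thesis by simp
qed

text \<open>If \<open>X\<close> is independent of \<open>N\<close>, it may be integrated out while \<open>N\<close>-measurable data are held fixed:
  the joint law of \<open>X\<close> and the identity map into \<open>(space M, N)\<close> is a product measure. Every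
  conditioning argument below is an instance.\<close>

lemma (in prob_space) nn_integral_freeze:
  assumes sub: "subalgebra M N" and D: "distributed M lborel X D"
    and ind: "indep_set (sets N) (sets (vimage_algebra (space M) X borel))"
    and f: "f \<in> borel_measurable (borel \<Otimes>\<^sub>M N)"
  shows "(\<integral>\<^sup>+\<omega>. f (X \<omega>, \<omega>) \<partial>M) = (\<integral>\<^sup>+x. D x * (\<integral>\<^sup>+\<omega>. f (x, \<omega>) \<partial>M) \<partial>lborel)"
proof -
  have X: "X \<in> borel_measurable M" using distributed_measurable[OF D] by simp
  have id: "(\<lambda>\<omega>. \<omega>) \<in> M \<rightarrow>\<^sub>M N" by (rule measurable_from_subalg_target[OF sub measurable_ident[unfolded id_def]])
  interpret X: prob_space "distr M borel X" by (rule prob_space_distr[OF X])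
  interpret N: prob_space "distr M N (\<lambda>\<omega>. \<omega>)" by (rule prob_space_distr[OF id])
  have pm: "(\<lambda>\<omega>. (X \<omega>, \<omega>)) \<in> M \<rightarrow>\<^sub>M borel \<Otimes>\<^sub>M N" by (intro measurable_Pair X id)
  have eq: "distr M borel X \<Otimes>\<^sub>M distr M N (\<lambda>\<omega>. \<omega>) = distr M (borel \<Otimes>\<^sub>M N) (\<lambda>\<omega>. (X \<omega>, \<omega>))"
  proof (rule pair_measure_eqI)
    fix A B assume "A \<in> sets (distr M borel X)" "B \<in> sets (distr M N (\<lambda>\<omega>. \<omega>))"
    then have A: "A \<in> sets borel" and B: "B \<in> sets N" by auto
    have BM: "B \<in> events" using B sub by (auto simp: subalgebra_def)
    have XA: "X -` A \<inter> space M \<in> events" using X A by (rule measurable_sets)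
    have "X -` A \<inter> space M \<in> sets (vimage_algebra (space M) X borel)"
      using A by (rule in_vimage_algebra)
    then have p: "prob (B \<inter> (X -` A \<inter> space M)) = prob B * prob (X -` A \<inter> space M)"
      by (rule indep_setD[OF ind B])
    have "(\<lambda>\<omega>. (X \<omega>, \<omega>)) -` (A \<times> B) \<inter> space M = B \<inter> (X -` A \<inter> space M)" by auto
    moreover have "(\<lambda>\<omega>. \<omega>) -` B \<inter> space M = B" using sets.sets_into_space[OF BM] by auto
    ultimately show "emeasure (distr M borel X) A * emeasure (distr M N (\<lambda>\<omega>. \<omega>)) B
        = emeasure (distr M (borel \<Otimes>\<^sub>M N) (\<lambda>\<omega>. (X \<omega>, \<omega>))) (A \<times> B)"
      using A B X id pm p BM XA
      by (simp add: emeasure_distr emeasure_eq_measure ennreal_mult'[symmetric] mult.commute)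
  qed (unfold_locales, simp)
  have f': "f \<in> borel_measurable (distr M borel X \<Otimes>\<^sub>M distr M N (\<lambda>\<omega>. \<omega>))"
    using f by (simp cong: measurable_cong_sets add: measurable_cong_sets[OF sets_pair_measure_cong[OF sets_distr sets_distr] refl])
  have fM: "f \<in> borel_measurable (borel \<Otimes>\<^sub>M M)" by (rule measurable_pair_subalgebra[OF sub f])
  have "(\<integral>\<^sup>+\<omega>. f (X \<omega>, \<omega>) \<partial>M) = (\<integral>\<^sup>+p. f p \<partial>distr M (borel \<Otimes>\<^sub>M N) (\<lambda>\<omega>. (X \<omega>, \<omega>)))"
    by (subst nn_integral_distr) (auto intro!: measurable_Pair X id f)
  also have "\<dots> = (\<integral>\<^sup>+x. \<integral>\<^sup>+\<omega>. f (x, \<omega>) \<partial>distr M N (\<lambda>\<omega>. \<omega>) \<partial>distr M borel X)"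
    unfolding eq[symmetric] by (rule N.nn_integral_fst[OF f', symmetric])
  also have "\<dots> = (\<integral>\<^sup>+x. \<integral>\<^sup>+\<omega>. f (x, \<omega>) \<partial>M \<partial>distr M borel X)"
    by (intro nn_integral_cong, subst nn_integral_distr[OF id])
       (auto intro: measurable_compose[OF measurable_Pair1' f])
  also have "\<dots> = (\<integral>\<^sup>+\<omega>'. \<integral>\<^sup>+\<omega>. f (X \<omega>', \<omega>) \<partial>M \<partial>M)"
    using fM X by (subst nn_integral_distr) (auto intro!: borel_measurable_nn_integral)
  also have "\<dots> = (\<integral>\<^sup>+x. D x * (\<integral>\<^sup>+\<omega>. f (x, \<omega>) \<partial>M) \<partial>lborel)"
    using fM by (intro distributed_nn_integral[OF D, symmetric]) (auto intro!: borel_measurable_nn_integral)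
  finally show ?thesis .
qed

lemma nn_integral_normal_density:
  fixes f :: "real \<Rightarrow> ennreal"
  assumes h: "0 < h" and f[measurable]: "f \<in> borel_measurable borel"
  shows "(\<integral>\<^sup>+x. normal_density 0 h x * f x \<partial>lborel) = (\<integral>\<^sup>+G. f (h * G) \<partial>std_normal_distribution)"
proof -
  have "(\<integral>\<^sup>+x. normal_density 0 h x * f x \<partial>lborel)
      = \<bar>h\<bar> * (\<integral>\<^sup>+x. normal_density 0 h (0 + h * x) * f (0 + h * x) \<partial>lborel)"
    using h by (intro nn_integral_real_affine) auto
  also have "\<dots> = (\<integral>\<^sup>+x. ennreal (std_normal_density x) * f (h * x) \<partial>lborel)"
    using h by (subst nn_integral_cmult[symmetric])
      (auto intro!: nn_integral_cong simp: mult.assoc[symmetric] ennreal_mult[symmetric]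
        normal_density_def real_sqrt_mult power_mult_distrib)
  also have "\<dots> = (\<integral>\<^sup>+G. f (h * G) \<partial>std_normal_distribution)"
    by (subst nn_integral_density) auto
  finally show ?thesis .
qed

lemma (in prob_space) nn_integral_freeze_normal:
  assumes sub: "subalgebra M N" and h: "0 < h" and D: "distributed M lborel X (normal_density 0 h)"
    and ind: "indep_set (sets N) (sets (vimage_algebra (space M) X borel))"
    and f: "f \<in> borel_measurable (borel \<Otimes>\<^sub>M N)"
  shows "(\<integral>\<^sup>+\<omega>. f (X \<omega>, \<omega>) \<partial>M) = (\<integral>\<^sup>+G. \<integral>\<^sup>+\<omega>. f (h * G, \<omega>) \<partial>M \<partial>std_normal_distribution)"
proof -
  have [measurable]: "f \<in> borel_measurable (borel \<Otimes>\<^sub>M M)" by (rule measurable_pair_subalgebra[OF sub f])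
  show ?thesis
    unfolding nn_integral_freeze[OF sub D ind f]
    by (rule nn_integral_normal_density[OF h]) measurable
qed

section \<open>The filter density of the killed particle\<close>

text \<open>Given the common increments \<open>\<xi>\<close>, this is the conditional density of the particle after \<open>k\<close> steps on the
  event that it was positive at every grid time. Each step convolves with the idiosyncratic noise of
  standard deviation \<open>s\<close>, shifts by \<open>d + sM * \<xi> k\<close>, and kills on the negative half-line.\<close>

primrec filter_density ::
  "(real \<Rightarrow> ennreal) \<Rightarrow> real \<Rightarrow> real \<Rightarrow> real \<Rightarrow> (nat \<Rightarrow> 'a \<Rightarrow> real) \<Rightarrow> nat \<Rightarrow> real \<Rightarrow> 'a \<Rightarrow> ennreal" where
  "filter_density V d sM s \<xi> 0 x \<omega> = V x"
| "filter_density V d sM s \<xi> (Suc k) x \<omega> = indicator {0<..} x *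
     (\<integral>\<^sup>+G. filter_density V d sM s \<xi> k (x - d - sM * \<xi> k \<omega> - s * G) \<omega> \<partial>std_normal_distribution)"

text \<open>The probability that two particles at \<open>x\<close> and \<open>y\<close>, which make \<open>k\<close> steps against the direction of the
  drift with common noise \<open>r * G0\<close> and own noises \<open>s * G1\<close> and \<open>s * G2\<close>, are both positive at every step.\<close>

primrec pair_survival :: "real \<Rightarrow> real \<Rightarrow> real \<Rightarrow> nat \<Rightarrow> real \<Rightarrow> real \<Rightarrow> ennreal" where
  "pair_survival d r s 0 x y = indicator {0<..} x * indicator {0<..} y"
| "pair_survival d r s (Suc k) x y = indicator {0<..} x * indicator {0<..} y *
     (\<integral>\<^sup>+G0. \<integral>\<^sup>+G1. \<integral>\<^sup>+G2. pair_survival d r s k (x - d - r * G0 - s * G1) (y - d - r * G0 - s * G2)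
       \<partial>std_normal_distribution \<partial>std_normal_distribution \<partial>std_normal_distribution)"

interpretation std_normal: prob_space std_normal_distribution
  by (rule prob_space_normal_density) simp

lemma measurable_filter_density:
  assumes V: "V \<in> borel_measurable borel" and \<xi>: "\<And>j. j < k \<Longrightarrow> \<xi> j \<in> borel_measurable N"
  shows "(\<lambda>(x, \<omega>). filter_density V d sM s \<xi> k x \<omega>) \<in> borel_measurable (borel \<Otimes>\<^sub>M N)"
  using \<xi>
proof (induction k)
  case 0
  then show ?case using V by simp
next
  case (Suc k)
  have \<xi>k[measurable]: "\<xi> k \<in> borel_measurable N" using Suc by simp
  have m[measurable]: "(\<lambda>(x, \<omega>). filter_density V d sM s \<xi> k x \<omega>) \<in> borel_measurable (borel \<Otimes>\<^sub>M N)"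
    using Suc by simp
  have "(\<lambda>q. (\<lambda>(x, \<omega>). filter_density V d sM s \<xi> k x \<omega>)
            (fst (fst q) - d - sM * \<xi> k (snd (fst q)) - s * snd q, snd (fst q)))
        \<in> borel_measurable ((borel \<Otimes>\<^sub>M N) \<Otimes>\<^sub>M std_normal_distribution)"
    by measurable
  then have [measurable]: "(\<lambda>(p, G). filter_density V d sM s \<xi> k (fst p - d - sM * \<xi> k (snd p) - s * G) (snd p))
        \<in> borel_measurable ((borel \<Otimes>\<^sub>M N) \<Otimes>\<^sub>M std_normal_distribution)"
    by (simp add: split_beta')
  have "(\<lambda>p. \<integral>\<^sup>+G. filter_density V d sM s \<xi> k (fst p - d - sM * \<xi> k (snd p) - s * G) (snd p)
      \<partial>std_normal_distribution) \<in> borel_measurable (borel \<Otimes>\<^sub>M N)"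
    by (rule std_normal.borel_measurable_nn_integral) measurable
  then show ?case by (simp add: split_beta')
qed

lemma measurable_pair_survival[measurable]:
  "(\<lambda>(x, y). pair_survival d r s k x y) \<in> borel_measurable (borel \<Otimes>\<^sub>M borel)"
proof (induction k)
  case (Suc k)
  note [measurable] = Suc
  let ?N = std_normal_distribution
  let ?P = "((borel \<Otimes>\<^sub>M borel) \<Otimes>\<^sub>M ?N) \<Otimes>\<^sub>M ?N"
  have "(\<lambda>q. (\<lambda>(x, y). pair_survival d r s k x y)
       (fst (fst (fst (fst q))) - d - r * snd (fst (fst q)) - s * snd (fst q),
        snd (fst (fst (fst q))) - d - r * snd (fst (fst q)) - s * snd q))
    \<in> borel_measurable (?P \<Otimes>\<^sub>M ?N)"
    by measurable
  then have "(\<lambda>q. \<integral>\<^sup>+G2. pair_survival d r s k (fst (fst (fst q)) - d - r * snd (fst q) - s * snd q)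
        (snd (fst (fst q)) - d - r * snd (fst q) - s * G2) \<partial>?N) \<in> borel_measurable ?P"
    by (intro std_normal.borel_measurable_nn_integral) (simp add: split_beta')
  then have "(\<lambda>q. \<integral>\<^sup>+G1. \<integral>\<^sup>+G2. pair_survival d r s k (fst (fst q) - d - r * snd q - s * G1)
        (snd (fst q) - d - r * snd q - s * G2) \<partial>?N \<partial>?N) \<in> borel_measurable ((borel \<Otimes>\<^sub>M borel) \<Otimes>\<^sub>M ?N)"
    by (intro std_normal.borel_measurable_nn_integral) (simp add: split_beta')
  then have [measurable]: "(\<lambda>p. \<integral>\<^sup>+G0. \<integral>\<^sup>+G1. \<integral>\<^sup>+G2. pair_survival d r s k (fst p - d - r * G0 - s * G1)
        (snd p - d - r * G0 - s * G2) \<partial>?N \<partial>?N \<partial>?N) \<in> borel_measurable (borel \<Otimes>\<^sub>M borel)"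
    by (intro std_normal.borel_measurable_nn_integral) (simp add: split_beta')
  show ?case by (simp add: split_beta')
qed simp

lemma pair_survival_le_1: "pair_survival d r s k x y \<le> 1"
proof (induction k arbitrary: x y)
  case (Suc k)
  have "(\<integral>\<^sup>+G0. \<integral>\<^sup>+G1. \<integral>\<^sup>+G2. pair_survival d r s k (x - d - r * G0 - s * G1) (y - d - r * G0 - s * G2)
       \<partial>std_normal_distribution \<partial>std_normal_distribution \<partial>std_normal_distribution)
    \<le> (\<integral>\<^sup>+G0. \<integral>\<^sup>+G1. \<integral>\<^sup>+G2. 1 \<partial>std_normal_distribution \<partial>std_normal_distribution \<partial>std_normal_distribution)"
    by (intro nn_integral_mono Suc)
  also have "\<dots> = 1" using std_normal.emeasure_space_1 by simp
  finally show ?case by (auto simp: indicator_def)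
qed (auto simp: indicator_def)


text \<open>A random walk with increments \<open>d + sM * \<xi> k + sI * \<eta> k\<close>, to be seen as a particle on a time grid.
  \<open>FW\<close> is the information carried by the common noise. \<open>Fk k\<close> is the past of the common noise at step \<open>k\<close>.
  \<open>Gk k\<close> contains all of \<open>FW\<close>, including its future, together with the past of the particle:
  the next own increment \<open>\<eta> k\<close> is independent even of that.\<close>

locale common_noise_chain = prob_space M for M :: "'a measure" +
  fixes FW :: "'a measure" and Fk Gk :: "nat \<Rightarrow> 'a measure" and X0 :: "'a \<Rightarrow> real"
    and \<xi> \<eta> :: "nat \<Rightarrow> 'a \<Rightarrow> real" and V :: "real \<Rightarrow> ennreal" and C :: ennreal
    and d sM sI h :: real and n :: nat
  assumes h: "0 < h"
    and V: "V \<in> borel_measurable borel" "\<And>x. V x \<le> C" "\<And>x. x \<le> 0 \<Longrightarrow> V x = 0"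
    and FW: "subalgebra M FW" "\<And>k. k < n \<Longrightarrow> \<xi> k \<in> borel_measurable FW"
    and Fk: "\<And>k. k < n \<Longrightarrow> subalgebra M (Fk k)"
      "\<And>j k. j < k \<Longrightarrow> k < n \<Longrightarrow> \<xi> j \<in> borel_measurable (Fk k)"
      "\<And>k. k < n \<Longrightarrow> indep_set (sets (Fk k)) (sets (vimage_algebra (space M) (\<xi> k) borel))"
      "\<And>k. k < n \<Longrightarrow> distributed M lborel (\<xi> k) (normal_density 0 h)"
    and Gk: "\<And>k. k < n \<Longrightarrow> subalgebra M (Gk k)" "\<And>k. k < n \<Longrightarrow> subalgebra (Gk k) FW"
      "\<And>k. k < n \<Longrightarrow> X0 \<in> borel_measurable (Gk k)"
      "\<And>j k. j < k \<Longrightarrow> k < n \<Longrightarrow> \<eta> j \<in> borel_measurable (Gk k)"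
      "\<And>k. k < n \<Longrightarrow> indep_set (sets (Gk k)) (sets (vimage_algebra (space M) (\<eta> k) borel))"
      "\<And>k. k < n \<Longrightarrow> distributed M lborel (\<eta> k) (normal_density 0 h)"
    and X0: "indep_set (sets FW) (sets (vimage_algebra (space M) X0 borel))" "distributed M lborel X0 V"
begin

abbreviation "q \<equiv> filter_density V d sM (sI * h) \<xi>"
abbreviation "u \<equiv> pair_survival d (sM * h) (sI * h)"

definition chain :: "nat \<Rightarrow> 'a \<Rightarrow> real" where
  "chain k \<omega> = X0 \<omega> + (\<Sum>j<k. d + sM * \<xi> j \<omega> + sI * \<eta> j \<omega>)"

definition alive :: "nat \<Rightarrow> 'a \<Rightarrow> ennreal" where
  "alive k \<omega> = (\<Prod>j\<le>k. indicator {0<..} (chain j \<omega>))"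

text \<open>Since the next common increment is independent of the filter density so far, the function
  \<open>E[q\<^sub>k(x) q\<^sub>k(y)]\<close> of \<open>(x, y)\<close> satisfies the same recursion as \<open>pair_survival\<close>, and initially it is at
  most \<open>C\<^sup>2\<close> on the quadrant. Following densities forward is the same as following two particles
  backward, so time reversal needs no argument of its own.\<close>

lemma filter_density_second_moment:
  assumes "k \<le> n"
  shows "(\<integral>\<^sup>+\<omega>. q k x \<omega> * q k y \<omega> \<partial>M) \<le> C\<^sup>2 * u k x y"
  using assms
proof (induction k arbitrary: x y)
  case 0
  have "V x * V y \<le> C\<^sup>2 * (indicator {0<..} x * indicator {0<..} y)"
    using V(2)[of x] V(2)[of y] V(3)[of x] V(3)[of y]
    by (auto simp: indicator_def power2_eq_square mult_mono)
  then show ?case using emeasure_space_1 by simp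
next
  case (Suc k)
  let ?N = std_normal_distribution
  let ?x = "\<lambda>w G. x - d - sM * w - sI * h * G" and ?y = "\<lambda>w G. y - d - sM * w - sI * h * G"
  let ?q = "\<lambda>(x, \<omega>). q k x \<omega>"
  have k: "k < n" using Suc by simp
  have qF[measurable]: "?q \<in> borel_measurable (borel \<Otimes>\<^sub>M Fk k)"
    using V Fk(2) k by (intro measurable_filter_density) auto
  have [measurable]: "?q \<in> borel_measurable (borel \<Otimes>\<^sub>M M)"
    by (rule measurable_pair_subalgebra[OF Fk(1)[OF k] qF])
  define f where "f p = (\<integral>\<^sup>+G. ?q (?x (fst p) G, snd p) \<partial>?N) * (\<integral>\<^sup>+G. ?q (?y (fst p) G, snd p) \<partial>?N)" for p
  have f: "f \<in> borel_measurable (borel \<Otimes>\<^sub>M Fk k)" unfolding f_def by measurable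
  have "(\<integral>\<^sup>+\<omega>. f (\<xi> k \<omega>, \<omega>) \<partial>M) = (\<integral>\<^sup>+G0. \<integral>\<^sup>+\<omega>. f (h * G0, \<omega>) \<partial>M \<partial>?N)"
    by (rule nn_integral_freeze_normal[OF Fk(1)[OF k] h Fk(4)[OF k] Fk(3)[OF k] f])
  also have "\<dots> \<le> (\<integral>\<^sup>+G0. C\<^sup>2 * (\<integral>\<^sup>+G1. \<integral>\<^sup>+G2. u k (?x (h * G0) G1) (?y (h * G0) G2) \<partial>?N \<partial>?N) \<partial>?N)"
  proof (rule nn_integral_mono)
    fix G0
    let ?w = "h * G0"
    have "(\<integral>\<^sup>+\<omega>. f (?w, \<omega>) \<partial>M)
        = (\<integral>\<^sup>+\<omega>. \<integral>\<^sup>+G1. \<integral>\<^sup>+G2. ?q (?x ?w G1, \<omega>) * ?q (?y ?w G2, \<omega>) \<partial>?N \<partial>?N \<partial>M)"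
      unfolding f_def fst_conv snd_conv
      by (intro nn_integral_cong) (simp add: nn_integral_cmult nn_integral_multc)
    also have "\<dots> = (\<integral>\<^sup>+G1. \<integral>\<^sup>+\<omega>. \<integral>\<^sup>+G2. ?q (?x ?w G1, \<omega>) * ?q (?y ?w G2, \<omega>) \<partial>?N \<partial>M \<partial>?N)"
      by (rule pair_sigma_finite.Fubini') (unfold_locales, measurable)
    also have "\<dots> = (\<integral>\<^sup>+G1. \<integral>\<^sup>+G2. \<integral>\<^sup>+\<omega>. ?q (?x ?w G1, \<omega>) * ?q (?y ?w G2, \<omega>) \<partial>M \<partial>?N \<partial>?N)"
      by (intro nn_integral_cong pair_sigma_finite.Fubini') (unfold_locales, measurable)
    also have "\<dots> \<le> (\<integral>\<^sup>+G1. \<integral>\<^sup>+G2. C\<^sup>2 * u k (?x ?w G1) (?y ?w G2) \<partial>?N \<partial>?N)"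
      using Suc by (intro nn_integral_mono) simp
    also have "\<dots> = C\<^sup>2 * (\<integral>\<^sup>+G1. \<integral>\<^sup>+G2. u k (?x ?w G1) (?y ?w G2) \<partial>?N \<partial>?N)"
      by (simp add: nn_integral_cmult)
    finally show "(\<integral>\<^sup>+\<omega>. f (?w, \<omega>) \<partial>M)
      \<le> C\<^sup>2 * (\<integral>\<^sup>+G1. \<integral>\<^sup>+G2. u k (?x ?w G1) (?y ?w G2) \<partial>?N \<partial>?N)" .
  qed
  also have "\<dots> = C\<^sup>2 * (\<integral>\<^sup>+G0. \<integral>\<^sup>+G1. \<integral>\<^sup>+G2. u k (?x (h * G0) G1) (?y (h * G0) G2) \<partial>?N \<partial>?N \<partial>?N)"
  proof (rule nn_integral_cmult)
    have "(\<lambda>p. (\<lambda>(x, y). u k x y) (?x (h * fst (fst p)) (snd (fst p)), ?y (h * fst (fst p)) (snd p)))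
        \<in> borel_measurable ((?N \<Otimes>\<^sub>M ?N) \<Otimes>\<^sub>M ?N)" by measurable
    then have "(\<lambda>p. \<integral>\<^sup>+G2. u k (?x (h * fst p) (snd p)) (?y (h * fst p) G2) \<partial>?N)
        \<in> borel_measurable (?N \<Otimes>\<^sub>M ?N)"
      by (intro std_normal.borel_measurable_nn_integral) (simp add: split_beta')
    then show "(\<lambda>G0. \<integral>\<^sup>+G1. \<integral>\<^sup>+G2. u k (?x (h * G0) G1) (?y (h * G0) G2) \<partial>?N \<partial>?N)
        \<in> borel_measurable ?N"
      by (intro std_normal.borel_measurable_nn_integral) (simp add: split_beta')
  qed
  finally have I: "(\<integral>\<^sup>+\<omega>. f (\<xi> k \<omega>, \<omega>) \<partial>M)
      \<le> C\<^sup>2 * (\<integral>\<^sup>+G0. \<integral>\<^sup>+G1. \<integral>\<^sup>+G2. u k (?x (h * G0) G1) (?y (h * G0) G2) \<partial>?N \<partial>?N \<partial>?N)" .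
  have "(\<integral>\<^sup>+\<omega>. q (Suc k) x \<omega> * q (Suc k) y \<omega> \<partial>M)
      = indicator {0<..} x * indicator {0<..} y * (\<integral>\<^sup>+\<omega>. f (\<xi> k \<omega>, \<omega>) \<partial>M)"
    by (auto simp: f_def indicator_def)
  then show ?case
    using mult_left_mono[OF I, of "indicator {0<..} x * indicator {0<..} y"]
    by (simp only: pair_survival.simps mult.assoc mult.left_commute[of "C\<^sup>2"]) simp
qed

lemma chain_measurable: "k \<le> n \<Longrightarrow> j < n \<Longrightarrow> k \<le> j \<Longrightarrow> chain k \<in> borel_measurable (Gk j)"
proof -
  assume A: "k \<le> n" "j < n" "k \<le> j"
  have "\<xi> i \<in> borel_measurable (Gk j)" if "i < k" for i
    using FW(2)[of i] A that measurable_from_subalg[OF Gk(2)[OF A(2)]] by auto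
  moreover have "\<eta> i \<in> borel_measurable (Gk j)" if "i < k" for i using Gk(4) A that by auto
  ultimately show ?thesis unfolding chain_def using Gk(3)[OF A(2)]
    by (intro borel_measurable_add borel_measurable_sum borel_measurable_times) auto
qed

lemma alive_measurable: "k \<le> n \<Longrightarrow> j < n \<Longrightarrow> k \<le> j \<Longrightarrow> alive k \<in> borel_measurable (Gk j)"
  unfolding alive_def
  by (intro borel_measurable_prod_ennreal) (auto intro!: measurable_compose[OF chain_measurable])

text \<open>The filter density is a conditional density given \<open>FW\<close>. The test function may depend on the full
  common noise and not only on its past: this makes the induction work, as integrating out \<open>\<eta> k\<close> turns
  \<open>\<Psi>\<close> into a function that involves \<open>\<xi> k\<close>.\<close>

lemma alive_expectation:
  assumes "k \<le> n" "(\<lambda>(x, \<omega>). \<Psi> x \<omega>) \<in> borel_measurable (borel \<Otimes>\<^sub>M FW)"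
  shows "(\<integral>\<^sup>+\<omega>. alive k \<omega> * \<Psi> (chain k \<omega>) \<omega> \<partial>M) = (\<integral>\<^sup>+\<omega>. \<integral>\<^sup>+x. \<Psi> x \<omega> * q k x \<omega> \<partial>lborel \<partial>M)"
  using assms
proof (induction k arbitrary: \<Psi>)
  case 0
  note \<Psi>[measurable] = 0(2) and [measurable] = V(1) measurable_pair_subalgebra[OF FW(1) 0(2)]
  have "(\<integral>\<^sup>+\<omega>. alive 0 \<omega> * \<Psi> (chain 0 \<omega>) \<omega> \<partial>M)
      = (\<integral>\<^sup>+\<omega>. (\<lambda>(x, \<omega>). indicator {0<..} x * \<Psi> x \<omega>) (X0 \<omega>, \<omega>) \<partial>M)"
    by (simp add: alive_def chain_def)
  also have "\<dots> = (\<integral>\<^sup>+x. V x * (\<integral>\<^sup>+\<omega>. (\<lambda>(x, \<omega>). indicator {0<..} x * \<Psi> x \<omega>) (x, \<omega>) \<partial>M) \<partial>lborel)"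
    by (rule nn_integral_freeze[OF FW(1) X0(2) X0(1)]) measurable
  also have "\<dots> = (\<integral>\<^sup>+x. \<integral>\<^sup>+\<omega>. \<Psi> x \<omega> * V x \<partial>M \<partial>lborel)"
  proof (rule nn_integral_cong)
    fix x
    have "(\<integral>\<^sup>+\<omega>. \<Psi> x \<omega> * V x \<partial>M) = (\<integral>\<^sup>+\<omega>. \<Psi> x \<omega> \<partial>M) * V x"
      by (rule nn_integral_multc) measurable
    then show "V x * (\<integral>\<^sup>+\<omega>. (\<lambda>(x, \<omega>). indicator {0<..} x * \<Psi> x \<omega>) (x, \<omega>) \<partial>M)
        = (\<integral>\<^sup>+\<omega>. \<Psi> x \<omega> * V x \<partial>M)"
      using V(3)[of x] by (cases "0 < x") (auto simp: mult.commute)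
  qed
  also have "\<dots> = (\<integral>\<^sup>+\<omega>. \<integral>\<^sup>+x. \<Psi> x \<omega> * V x \<partial>lborel \<partial>M)"
    by (rule pair_sigma_finite.Fubini') (unfold_locales, measurable)
  finally show ?case by simp
next
  case (Suc k)
  let ?N = std_normal_distribution
  have k: "k < n" using Suc by simp
  note \<Psi>[measurable] = Suc(3)
  note \<Psi>M[measurable] = measurable_pair_subalgebra[OF FW(1) Suc(3)]
  note \<Psi>G[measurable] = measurable_pair_subalgebra[OF Gk(2)[OF k] Suc(3)]
  note \<xi>W[measurable] = FW(2)[OF k]
  note [measurable] = measurable_from_subalg[OF FW(1) \<xi>W] measurable_from_subalg[OF Gk(2)[OF k] \<xi>W]
  have [measurable]: "chain k \<in> borel_measurable (Gk k)" "alive k \<in> borel_measurable (Gk k)"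
    using k by (auto intro: chain_measurable alive_measurable)
  have qW[measurable]: "(\<lambda>(x, \<omega>). q k x \<omega>) \<in> borel_measurable (borel \<Otimes>\<^sub>M FW)"
    using V FW(2) k by (intro measurable_filter_density) auto
  note [measurable] = measurable_pair_subalgebra[OF FW(1) qW]
  let ?\<Phi> = "\<lambda>x \<omega>. indicator {0<..} x * \<Psi> x \<omega>"
  let ?s = "\<lambda>\<omega> G. d + sM * \<xi> k \<omega> + sI * (h * G)"
  have "(\<integral>\<^sup>+\<omega>. alive (Suc k) \<omega> * \<Psi> (chain (Suc k) \<omega>) \<omega> \<partial>M)
      = (\<integral>\<^sup>+\<omega>. (\<lambda>(e, \<omega>). alive k \<omega> * ?\<Phi> (chain k \<omega> + (d + sM * \<xi> k \<omega> + sI * e)) \<omega>) (\<eta> k \<omega>, \<omega>) \<partial>M)"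
    by (simp add: alive_def chain_def atMost_Suc mult_ac add_ac)
  also have "\<dots> = (\<integral>\<^sup>+G. \<integral>\<^sup>+\<omega>. (\<lambda>(e, \<omega>). alive k \<omega> * ?\<Phi> (chain k \<omega> + (d + sM * \<xi> k \<omega> + sI * e)) \<omega>) (h * G, \<omega>) \<partial>M \<partial>?N)"
  proof (rule nn_integral_freeze_normal[OF Gk(1)[OF k] h Gk(6)[OF k] Gk(5)[OF k]])
    have "(\<lambda>p. alive k (snd p) * (\<lambda>(x, \<omega>). ?\<Phi> x \<omega>) (chain k (snd p) + (d + sM * \<xi> k (snd p) + sI * fst p), snd p))
        \<in> borel_measurable (borel \<Otimes>\<^sub>M Gk k)" by measurable
    then show "(\<lambda>(e, \<omega>). alive k \<omega> * ?\<Phi> (chain k \<omega> + (d + sM * \<xi> k \<omega> + sI * e)) \<omega>)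
        \<in> borel_measurable (borel \<Otimes>\<^sub>M Gk k)" by (simp add: split_beta')
  qed
  also have "\<dots> = (\<integral>\<^sup>+G. \<integral>\<^sup>+\<omega>. alive k \<omega> * ?\<Phi> (chain k \<omega> + ?s \<omega> G) \<omega> \<partial>M \<partial>?N)" by simp
  also have "\<dots> = (\<integral>\<^sup>+G. \<integral>\<^sup>+\<omega>. \<integral>\<^sup>+x. ?\<Phi> (x + ?s \<omega> G) \<omega> * q k x \<omega> \<partial>lborel \<partial>M \<partial>?N)"
  proof (rule nn_integral_cong)
    fix G
    have "(\<lambda>p. (\<lambda>(x, \<omega>). ?\<Phi> x \<omega>) (fst p + ?s (snd p) G, snd p)) \<in> borel_measurable (borel \<Otimes>\<^sub>M FW)"
      by measurable
    then show "(\<integral>\<^sup>+\<omega>. alive k \<omega> * ?\<Phi> (chain k \<omega> + ?s \<omega> G) \<omega> \<partial>M)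
        = (\<integral>\<^sup>+\<omega>. \<integral>\<^sup>+x. ?\<Phi> (x + ?s \<omega> G) \<omega> * q k x \<omega> \<partial>lborel \<partial>M)"
      using k by (intro Suc.IH) (simp_all add: split_beta')
  qed
  also have "\<dots> = (\<integral>\<^sup>+G. \<integral>\<^sup>+\<omega>. \<integral>\<^sup>+x. ?\<Phi> x \<omega> * q k (x - ?s \<omega> G) \<omega> \<partial>lborel \<partial>M \<partial>?N)"
  proof (rule nn_integral_cong, rule nn_integral_cong)
    fix G \<omega> assume \<omega>: "\<omega> \<in> space M"
    have [measurable]: "(\<lambda>x. \<Psi> x \<omega>) \<in> borel_measurable borel" "(\<lambda>x. q k x \<omega>) \<in> borel_measurable borel"
      using measurable_Pair1[OF \<Psi>M \<omega>] measurable_Pair1[OF measurable_pair_subalgebra[OF FW(1) qW] \<omega>]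
      by simp_all
    \<comment> \<open>translation invariance moves the increment from the test function to the density\<close>
    have "(\<integral>\<^sup>+x. ?\<Phi> x \<omega> * q k (x - ?s \<omega> G) \<omega> \<partial>lborel)
      = ennreal \<bar>1\<bar> * (\<integral>\<^sup>+x. ?\<Phi> (?s \<omega> G + 1 * x) \<omega> * q k (?s \<omega> G + 1 * x - ?s \<omega> G) \<omega> \<partial>lborel)"
      by (rule nn_integral_real_affine) auto
    then show "(\<integral>\<^sup>+x. ?\<Phi> (x + ?s \<omega> G) \<omega> * q k x \<omega> \<partial>lborel)
        = (\<integral>\<^sup>+x. ?\<Phi> x \<omega> * q k (x - ?s \<omega> G) \<omega> \<partial>lborel)" by (simp add: add.commute)
  qed
  also have "\<dots> = (\<integral>\<^sup>+\<omega>. \<integral>\<^sup>+G. \<integral>\<^sup>+x. ?\<Phi> x \<omega> * q k (x - ?s \<omega> G) \<omega> \<partial>lborel \<partial>?N \<partial>M)"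
  proof (rule pair_sigma_finite.Fubini')
    show "pair_sigma_finite M ?N" by unfold_locales
    have "(\<lambda>p. (\<lambda>(x, \<omega>). ?\<Phi> x \<omega>) (snd p, fst (fst p))
         * (\<lambda>(x, \<omega>). q k x \<omega>) (snd p - ?s (fst (fst p)) (snd (fst p)), fst (fst p)))
        \<in> borel_measurable ((M \<Otimes>\<^sub>M ?N) \<Otimes>\<^sub>M lborel)" by measurable
    then show "(\<lambda>(\<omega>, G). \<integral>\<^sup>+x. ?\<Phi> x \<omega> * q k (x - ?s \<omega> G) \<omega> \<partial>lborel) \<in> borel_measurable (M \<Otimes>\<^sub>M ?N)"
      unfolding split_beta' by (intro lborel.borel_measurable_nn_integral) (simp add: split_beta')
  qed
  also have "\<dots> = (\<integral>\<^sup>+\<omega>. \<integral>\<^sup>+x. \<Psi> x \<omega> * q (Suc k) x \<omega> \<partial>lborel \<partial>M)"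
  proof (rule nn_integral_cong)
    fix \<omega> assume \<omega>: "\<omega> \<in> space M"
    have [measurable]: "(\<lambda>x. \<Psi> x \<omega>) \<in> borel_measurable borel" "(\<lambda>x. q k x \<omega>) \<in> borel_measurable borel"
      using measurable_Pair1[OF \<Psi>M \<omega>] measurable_Pair1[OF measurable_pair_subalgebra[OF FW(1) qW] \<omega>]
      by simp_all
    have "(\<integral>\<^sup>+G. \<integral>\<^sup>+x. ?\<Phi> x \<omega> * q k (x - ?s \<omega> G) \<omega> \<partial>lborel \<partial>?N)
       = (\<integral>\<^sup>+x. \<integral>\<^sup>+G. ?\<Phi> x \<omega> * q k (x - ?s \<omega> G) \<omega> \<partial>?N \<partial>lborel)"
      by (rule pair_sigma_finite.Fubini') (unfold_locales, measurable)
    also have "\<dots> = (\<integral>\<^sup>+x. \<Psi> x \<omega> * q (Suc k) x \<omega> \<partial>lborel)"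
    proof (rule nn_integral_cong)
      fix x
      have e: "x - ?s \<omega> G = x - d - sM * \<xi> k \<omega> - sI * h * G" for G by simp
      have "(\<integral>\<^sup>+G. ?\<Phi> x \<omega> * q k (x - ?s \<omega> G) \<omega> \<partial>?N) = ?\<Phi> x \<omega> * (\<integral>\<^sup>+G. q k (x - ?s \<omega> G) \<omega> \<partial>?N)"
        by (rule nn_integral_cmult) measurable
      then show "(\<integral>\<^sup>+G. ?\<Phi> x \<omega> * q k (x - ?s \<omega> G) \<omega> \<partial>?N) = \<Psi> x \<omega> * q (Suc k) x \<omega>"
        unfolding e filter_density.simps by (simp only: mult_ac)
    qed
    finally show "(\<integral>\<^sup>+G. \<integral>\<^sup>+x. ?\<Phi> x \<omega> * q k (x - ?s \<omega> G) \<omega> \<partial>lborel \<partial>?N)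
      = (\<integral>\<^sup>+x. \<Psi> x \<omega> * q (Suc k) x \<omega> \<partial>lborel)" .
  qed
  finally show ?case .
qed

end

section \<open>Survival of two particles\<close>

lemma nn_integral_pair_survival_cmult:
  "c * (\<integral>\<^sup>+G0. \<integral>\<^sup>+G1. \<integral>\<^sup>+G2. pair_survival d r s k (x - d - r * G0 - s * G1) (y - d - r * G0 - s * G2)
       \<partial>std_normal_distribution \<partial>std_normal_distribution \<partial>std_normal_distribution)
   = (\<integral>\<^sup>+G0. \<integral>\<^sup>+G1. \<integral>\<^sup>+G2. c * pair_survival d r s k (x - d - r * G0 - s * G1) (y - d - r * G0 - s * G2)
       \<partial>std_normal_distribution \<partial>std_normal_distribution \<partial>std_normal_distribution)"
proof -
  let ?N = std_normal_distribution
  let ?u = "\<lambda>G0 G1 G2. pair_survival d r s k (x - d - r * G0 - s * G1) (y - d - r * G0 - s * G2)"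
  have "(\<lambda>p. (\<lambda>(x, y). pair_survival d r s k x y)
        (x - d - r * fst (fst p) - s * snd (fst p), y - d - r * fst (fst p) - s * snd p))
      \<in> borel_measurable ((?N \<Otimes>\<^sub>M ?N) \<Otimes>\<^sub>M ?N)" by measurable
  then have m2: "(\<lambda>p. \<integral>\<^sup>+G2. ?u (fst p) (snd p) G2 \<partial>?N) \<in> borel_measurable (?N \<Otimes>\<^sub>M ?N)"
    by (intro std_normal.borel_measurable_nn_integral) (simp add: split_beta')
  then have m1: "(\<lambda>G0. \<integral>\<^sup>+G1. \<integral>\<^sup>+G2. ?u G0 G1 G2 \<partial>?N \<partial>?N) \<in> borel_measurable ?N"
    by (intro std_normal.borel_measurable_nn_integral) (simp add: split_beta')
  have "c * (\<integral>\<^sup>+G0. \<integral>\<^sup>+G1. \<integral>\<^sup>+G2. ?u G0 G1 G2 \<partial>?N \<partial>?N \<partial>?N)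
      = (\<integral>\<^sup>+G0. c * (\<integral>\<^sup>+G1. \<integral>\<^sup>+G2. ?u G0 G1 G2 \<partial>?N \<partial>?N) \<partial>?N)"
    by (rule nn_integral_cmult[OF m1, symmetric])
  also have "\<dots> = (\<integral>\<^sup>+G0. \<integral>\<^sup>+G1. c * (\<integral>\<^sup>+G2. ?u G0 G1 G2 \<partial>?N) \<partial>?N \<partial>?N)"
    using measurable_Pair2[OF m2] by (intro nn_integral_cong nn_integral_cmult[symmetric]) simp
  also have "\<dots> = (\<integral>\<^sup>+G0. \<integral>\<^sup>+G1. \<integral>\<^sup>+G2. c * ?u G0 G1 G2 \<partial>?N \<partial>?N \<partial>?N)"
    by (rule nn_integral_cong, rule nn_integral_cong, rule nn_integral_cmult[symmetric]) measurable
  finally show ?thesis .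
qed

lemma pair_survival_outside: "\<not> (0 < x \<and> 0 < y) \<Longrightarrow> pair_survival d r s k x y = 0"
  by (cases k) auto

context wedge_barrier
begin

text \<open>Summing the decrease \<open>\<delta> / 2\<close> of the barrier over the steps survived: survival up to step \<open>n\<close> implies
  survival at all earlier steps, so \<open>n \<delta> / 2\<close> times its probability is at most the initial value, times
  the accumulated growth. In the induction the new summand \<open>\<delta> / 2 * u\<close> is at most \<open>\<delta> / 2\<close>, which
  the decrease of one step compensates.\<close>

lemma pair_survival_le_barrier:
  assumes e: "0 < e"
  shows "\<exists>\<delta>0>0. \<forall>\<delta> n x y. 0 < \<delta> \<longrightarrow> \<delta> \<le> \<delta>0 \<longrightarrow>
     ennreal (\<delta> / 2 * real n) * pair_survival (\<mu> * \<delta>) (\<sigma>M * sqrt \<delta>) (\<sigma>I * sqrt \<delta>) n x y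
       \<le> ennreal ((1 + \<delta> / (2 * R\<^sup>2)) ^ n * barrier e x y)"
proof -
  obtain \<delta>0 where \<delta>0: "0 < \<delta>0" and step: "\<And>\<delta> x y k. \<lbrakk>0 < \<delta>; \<delta> \<le> \<delta>0; 0 < x; 0 < y; 0 \<le> k\<rbrakk> \<Longrightarrow>
     0 \<le> (1 + \<delta> / (2 * R\<^sup>2)) * barrier e x y - \<delta> / 2 \<and>
     (\<integral>\<^sup>+G0. \<integral>\<^sup>+G1. \<integral>\<^sup>+G2. ennreal (k * barrier e
           (x - \<mu> * \<delta> - \<sigma>M * sqrt \<delta> * G0 - \<sigma>I * sqrt \<delta> * G1)
           (y - \<mu> * \<delta> - \<sigma>M * sqrt \<delta> * G0 - \<sigma>I * sqrt \<delta> * G2))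
       \<partial>std_normal_distribution \<partial>std_normal_distribution \<partial>std_normal_distribution)
     \<le> ennreal (k * ((1 + \<delta> / (2 * R\<^sup>2)) * barrier e x y - \<delta> / 2))"
    using barrier_step[OF e] by blast
  have "ennreal (\<delta> / 2 * real n) * pair_survival (\<mu> * \<delta>) (\<sigma>M * sqrt \<delta>) (\<sigma>I * sqrt \<delta>) n x y
       \<le> ennreal ((1 + \<delta> / (2 * R\<^sup>2)) ^ n * barrier e x y)" if \<delta>: "0 < \<delta>" "\<delta> \<le> \<delta>0" for \<delta> n x y
  proof (induction n arbitrary: x y)
    case 0
    then show ?case by simp
  next
    case (Suc n)
    let ?u = "pair_survival (\<mu> * \<delta>) (\<sigma>M * sqrt \<delta>) (\<sigma>I * sqrt \<delta>)"
    let ?k = "(1 + \<delta> / (2 * R\<^sup>2)) ^ n" and ?f = "(1 + \<delta> / (2 * R\<^sup>2)) * barrier e x y"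
    show ?case
    proof (cases "0 < x \<and> 0 < y")
      case False
      then show ?thesis by (subst pair_survival_outside) auto
    next
      case True
      have k: "1 \<le> ?k" using \<delta> by (intro one_le_power) auto
      then have k0: "0 \<le> ?k" by linarith
      note st = step[OF \<delta> conjunct1[OF True] conjunct2[OF True] k0]
      have "ennreal (\<delta> / 2 * real n) * ?u (Suc n) x y \<le> ennreal (?k * (?f - \<delta> / 2))"
      proof -
        have "ennreal (\<delta> / 2 * real n) * ?u (Suc n) x y = ennreal (\<delta> / 2 * real n) *
            (\<integral>\<^sup>+G0. \<integral>\<^sup>+G1. \<integral>\<^sup>+G2. ?u n (x - \<mu> * \<delta> - \<sigma>M * sqrt \<delta> * G0 - \<sigma>I * sqrt \<delta> * G1)
                (y - \<mu> * \<delta> - \<sigma>M * sqrt \<delta> * G0 - \<sigma>I * sqrt \<delta> * G2)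
              \<partial>std_normal_distribution \<partial>std_normal_distribution \<partial>std_normal_distribution)"
          using True by simp
        also have "\<dots> \<le> ennreal (?k * (?f - \<delta> / 2))"
          unfolding nn_integral_pair_survival_cmult
          by (rule order_trans[OF _ conjunct2[OF st]]) (intro nn_integral_mono Suc)
        finally show ?thesis .
      qed
      moreover have "ennreal (\<delta> / 2) * ?u (Suc n) x y \<le> ennreal (\<delta> / 2)"
        using mult_left_mono[OF pair_survival_le_1] by (metis mult.right_neutral zero_le)
      ultimately have "ennreal (\<delta> / 2 * real n) * ?u (Suc n) x y + ennreal (\<delta> / 2) * ?u (Suc n) x y
          \<le> ennreal (?k * (?f - \<delta> / 2)) + ennreal (\<delta> / 2)" by (rule add_mono)
      also have "\<dots> = ennreal (?k * (?f - \<delta> / 2) + \<delta> / 2)"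
        using st k0 \<delta> by (intro ennreal_plus[symmetric] mult_nonneg_nonneg) auto
      also have "\<dots> \<le> ennreal (?k * ?f)"
        using mult_right_mono[OF k, of "\<delta> / 2"] \<delta> by (intro ennreal_leI) (simp add: algebra_simps)
      also have "?k * ?f = (1 + \<delta> / (2 * R\<^sup>2)) ^ Suc n * barrier e x y" by simp
      also have "ennreal (\<delta> / 2 * real n) * ?u (Suc n) x y + ennreal (\<delta> / 2) * ?u (Suc n) x y
          = ennreal (\<delta> / 2 * real (Suc n)) * ?u (Suc n) x y"
      proof -
        have "\<delta> / 2 * real (Suc n) = \<delta> / 2 * real n + \<delta> / 2" by (simp add: field_simps)
        then show ?thesis using \<delta> by (simp only: ennreal_plus mult_nonneg_nonneg distrib_right)
      qed
      finally show ?thesis .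
    qed
  qed
  then show ?thesis using \<delta>0 by blast
qed

lemma norm_point_le:
  assumes "0 < x" "x < e" "0 < y" "y < e"
  shows "norm (point e x y) \<le> (4 / a + 1 / b) * e"
proof -
  have "norm (point e x y) \<le> (x + y + 2 * e) / a + \<bar>x - y\<bar> / b"
    using cmod_le[of "point e x y"] assms a_pos b_pos by (simp add: point_def abs_divide)
  also have "\<dots> \<le> (4 * e) / a + e / b"
    using assms a_pos b_pos by (intro add_mono divide_right_mono) auto
  finally show ?thesis by (simp add: algebra_simps)
qed

text \<open>At points of \<open>(0, e)\<^sup>2\<close> the barrier is of order \<open>e\<^sup>p\<close>, with a constant uniform in \<open>e\<close> and \<open>t\<close>. Only the
  number \<open>n\<close> of grid steps has to grow as \<open>e\<close> tends to \<open>0\<close>.\<close>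

lemma pair_survival_bound:
  fixes T :: real
  shows "\<exists>K>0. \<forall>e>0. \<forall>t. 0 < t \<longrightarrow> t \<le> T \<longrightarrow>
     (\<exists>n>0. \<forall>x y. 0 < x \<longrightarrow> x < e \<longrightarrow> 0 < y \<longrightarrow> y < e \<longrightarrow>
        pair_survival (\<mu> * (t / real n)) (\<sigma>M * sqrt (t / real n)) (\<sigma>I * sqrt (t / real n)) n x y
          \<le> ennreal (K * e powr p / t))"
proof (intro exI[of _ "2 * exp (T / (2 * R\<^sup>2)) * A * (4 / a + 1 / b) powr p"] conjI allI impI)
  have ab: "0 < 4 / a + 1 / b" using a_pos b_pos by (simp add: add_pos_pos)
  have R2: "0 < R\<^sup>2" using R_bounds by simp
  show "0 < 2 * exp (T / (2 * R\<^sup>2)) * A * (4 / a + 1 / b) powr p"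
    using A_pos ab by auto
  fix e t :: real assume e: "0 < e" and t: "0 < t" "t \<le> T"
  obtain \<delta>0 where \<delta>0: "0 < \<delta>0" and le: "\<And>\<delta> n x y. \<lbrakk>0 < \<delta>; \<delta> \<le> \<delta>0\<rbrakk> \<Longrightarrow>
     ennreal (\<delta> / 2 * real n) * pair_survival (\<mu> * \<delta>) (\<sigma>M * sqrt \<delta>) (\<sigma>I * sqrt \<delta>) n x y
       \<le> ennreal ((1 + \<delta> / (2 * R\<^sup>2)) ^ n * barrier e x y)"
    using pair_survival_le_barrier[OF e] by blast
  obtain n where "t / \<delta>0 < real n" using reals_Archimedean2 by blast
  moreover have "0 < t / \<delta>0" using t \<delta>0 by simp
  ultimately have n: "0 < n" "t / \<delta>0 < real n" using less_trans by (auto simp flip: of_nat_0_less_iff)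
  define \<delta> where "\<delta> = t / real n"
  have \<delta>: "0 < \<delta>" "\<delta> \<le> \<delta>0" "\<delta> * real n = t" using n t \<delta>0 by (auto simp: \<delta>_def field_simps)
  show "\<exists>n>0. \<forall>x y. 0 < x \<longrightarrow> x < e \<longrightarrow> 0 < y \<longrightarrow> y < e \<longrightarrow>
        pair_survival (\<mu> * (t / real n)) (\<sigma>M * sqrt (t / real n)) (\<sigma>I * sqrt (t / real n)) n x y
          \<le> ennreal (2 * exp (T / (2 * R\<^sup>2)) * A * (4 / a + 1 / b) powr p * e powr p / t)"
  proof (intro exI[of _ n] conjI allI impI n)
    fix x y assume xy: "0 < x" "x < e" "0 < y" "y < e"
    let ?u = "pair_survival (\<mu> * \<delta>) (\<sigma>M * sqrt \<delta>) (\<sigma>I * sqrt \<delta>) n x y"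
    have "(1 + \<delta> / (2 * R\<^sup>2)) ^ n \<le> exp (\<delta> / (2 * R\<^sup>2)) ^ n"
      using \<delta> by (intro power_mono exp_ge_add_one_self) auto
    also have "\<dots> = exp (t / (2 * R\<^sup>2))"
      using \<delta> by (simp add: exp_of_nat_mult[symmetric] mult.commute)
    also have "\<dots> \<le> exp (T / (2 * R\<^sup>2))" using t R2 by (simp add: divide_right_mono)
    finally have E: "(1 + \<delta> / (2 * R\<^sup>2)) ^ n \<le> exp (T / (2 * R\<^sup>2))" .
    have "barrier e x y \<le> A * norm (point e x y) powr p" using xy e by (intro barrier_le_powr) auto
    also have "\<dots> \<le> A * ((4 / a + 1 / b) * e) powr p"
      using A_pos p norm_point_le[OF xy] by (intro mult_left_mono powr_mono2) auto
    also have "\<dots> = A * (4 / a + 1 / b) powr p * e powr p"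
      using ab e by (simp add: powr_mult)
    finally have B: "barrier e x y \<le> A * (4 / a + 1 / b) powr p * e powr p" .
    have "ennreal (t / 2) * ?u \<le> ennreal ((1 + \<delta> / (2 * R\<^sup>2)) ^ n * barrier e x y)"
      using le[OF \<delta>(1,2), of n x y] \<delta>(3) by simp
    also have "\<dots> \<le> ennreal (exp (T / (2 * R\<^sup>2)) * (A * (4 / a + 1 / b) powr p * e powr p))"
      using E B barrier_nonneg[OF e] by (intro ennreal_leI mult_mono) auto
    finally have "ennreal (2 / t) * (ennreal (t / 2) * ?u)
        \<le> ennreal (2 / t) * ennreal (exp (T / (2 * R\<^sup>2)) * (A * (4 / a + 1 / b) powr p * e powr p))"
      by (rule mult_left_mono) simp
    also have "\<dots> = ennreal (2 * exp (T / (2 * R\<^sup>2)) * A * (4 / a + 1 / b) powr p * e powr p / t)"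
      using t by (subst ennreal_mult'[symmetric]) (auto simp: mult_ac)
    also have "ennreal (2 / t) * (ennreal (t / 2) * ?u) = ?u"
      using t by (simp add: mult.assoc[symmetric] ennreal_mult[symmetric])
    finally show "pair_survival (\<mu> * (t / real n)) (\<sigma>M * sqrt (t / real n)) (\<sigma>I * sqrt (t / real n)) n x y
          \<le> ennreal (2 * exp (T / (2 * R\<^sup>2)) * A * (4 / a + 1 / b) powr p * e powr p / t)"
      by (simp add: \<delta>_def)
  qed
qed

end

section \<open>Second moment of the surviving mass\<close>

lemma ennreal_two_mult_le: "2 * (x * y) \<le> x\<^sup>2 + y\<^sup>2" for x y :: ennreal
proof (cases x; cases y)
  fix r s assume "x = ennreal r" "0 \<le> r" "y = ennreal s" "0 \<le> s"
  moreover have "ennreal (2 * (r * s)) \<le> ennreal (r\<^sup>2 + s\<^sup>2)"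
    using sum_squares_bound[of r s] by (intro ennreal_leI) simp
  ultimately show ?thesis by (simp add: ennreal_mult ennreal_power)
qed (simp_all add: power2_eq_square ennreal_mult_top ennreal_top_mult)

context common_noise_chain
begin

definition mass :: "real \<Rightarrow> 'a \<Rightarrow> ennreal" where
  "mass e \<omega> = (\<integral>\<^sup>+x. indicator {0<..<e} x * q n x \<omega> \<partial>lborel)"

lemma filter_density_measurable: "(\<lambda>(x, \<omega>). q n x \<omega>) \<in> borel_measurable (borel \<Otimes>\<^sub>M M)"
  using V(1) FW(2) by (intro measurable_pair_subalgebra[OF FW(1)] measurable_filter_density)

lemma mass_measurable: "mass e \<in> borel_measurable M"
proof -
  note [measurable] = filter_density_measurable
  have "(\<lambda>p. indicator {0<..<e} (snd p) * (\<lambda>(x, \<omega>). q n x \<omega>) (snd p, fst p)) \<in> borel_measurable (M \<Otimes>\<^sub>M lborel)"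
    by measurable
  then show ?thesis unfolding mass_def
    by (intro lborel.borel_measurable_nn_integral) (simp add: split_beta')
qed

text \<open>The square of the mass is a double integral over \<open>(0, e)\<^sup>2\<close>, a set of area \<open>e\<^sup>2\<close>; exchange it with the
  expectation.\<close>

lemma mass_second_moment:
  assumes e: "0 < e" and K: "\<And>x y. \<lbrakk>0 < x; x < e; 0 < y; y < e\<rbrakk> \<Longrightarrow> u n x y \<le> K"
  shows "(\<integral>\<^sup>+\<omega>. (mass e \<omega>)\<^sup>2 \<partial>M) \<le> C\<^sup>2 * K * ennreal (e\<^sup>2)"
proof -
  note [measurable] = filter_density_measurable
  let ?I = "\<lambda>x. indicator {0<..<e} x :: ennreal" and ?q = "\<lambda>(x, \<omega>). q n x \<omega>"
  have "(\<integral>\<^sup>+\<omega>. (mass e \<omega>)\<^sup>2 \<partial>M) = (\<integral>\<^sup>+\<omega>. \<integral>\<^sup>+x. \<integral>\<^sup>+y. ?I x * ?q (x, \<omega>) * (?I y * ?q (y, \<omega>)) \<partial>lborel \<partial>lborel \<partial>M)"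
  proof (rule nn_integral_cong)
    fix \<omega> assume \<omega>: "\<omega> \<in> space M"
    have [measurable]: "(\<lambda>x. q n x \<omega>) \<in> borel_measurable borel"
      using measurable_Pair1[OF filter_density_measurable \<omega>] by simp
    have "(mass e \<omega>)\<^sup>2 = (\<integral>\<^sup>+x. ?I x * q n x \<omega> * mass e \<omega> \<partial>lborel)"
      unfolding power2_eq_square by (subst nn_integral_multc) (measurable, simp add: mass_def)
    also have "\<dots> = (\<integral>\<^sup>+x. \<integral>\<^sup>+y. ?I x * q n x \<omega> * (?I y * q n y \<omega>) \<partial>lborel \<partial>lborel)"
      unfolding mass_def by (rule nn_integral_cong, rule nn_integral_cmult[symmetric]) measurable
    finally show "(mass e \<omega>)\<^sup>2 = (\<integral>\<^sup>+x. \<integral>\<^sup>+y. ?I x * ?q (x, \<omega>) * (?I y * ?q (y, \<omega>)) \<partial>lborel \<partial>lborel)"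
      by simp
  qed
  also have "\<dots> = (\<integral>\<^sup>+x. \<integral>\<^sup>+\<omega>. \<integral>\<^sup>+y. ?I x * ?q (x, \<omega>) * (?I y * ?q (y, \<omega>)) \<partial>lborel \<partial>M \<partial>lborel)"
    by (rule pair_sigma_finite.Fubini') (unfold_locales, measurable)
  also have "\<dots> = (\<integral>\<^sup>+x. \<integral>\<^sup>+y. \<integral>\<^sup>+\<omega>. ?I x * ?q (x, \<omega>) * (?I y * ?q (y, \<omega>)) \<partial>M \<partial>lborel \<partial>lborel)"
    by (rule nn_integral_cong, rule pair_sigma_finite.Fubini') (unfold_locales, measurable)
  also have "\<dots> \<le> (\<integral>\<^sup>+x. \<integral>\<^sup>+y. ?I x * (?I y * (C\<^sup>2 * K)) \<partial>lborel \<partial>lborel)"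
  proof (rule nn_integral_mono, rule nn_integral_mono)
    fix x y
    have "(\<integral>\<^sup>+\<omega>. q n x \<omega> * q n y \<omega> \<partial>M) \<le> C\<^sup>2 * K" if "0 < x" "x < e" "0 < y" "y < e"
      using order_trans[OF filter_density_second_moment mult_left_mono[OF K[OF that]]] by simp
    then show "(\<integral>\<^sup>+\<omega>. ?I x * ?q (x, \<omega>) * (?I y * ?q (y, \<omega>)) \<partial>M) \<le> ?I x * (?I y * (C\<^sup>2 * K))"
      by (auto simp: indicator_def)
  qed
  also have "\<dots> = C\<^sup>2 * K * ennreal (e\<^sup>2)"
    using e by (simp add: nn_integral_cmult nn_integral_multc ennreal_mult power2_eq_square mult_ac)
  finally show ?thesis .
qed

text \<open>The right-hand side of the assumption is \<open>E[v * mass]\<close>, so \<open>2 E[v\<^sup>2] \<le> 2 E[v * mass] \<le> E[v\<^sup>2] + E[mass\<^sup>2]\<close>.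
  For a conditional probability \<open>v\<close> this compares with \<open>mass\<close> in mean square without an almost sure comparison
  of the two.\<close>

lemma second_moment_le_mass:
  assumes v: "v \<in> borel_measurable FW" and fin: "(\<integral>\<^sup>+\<omega>. (v \<omega>)\<^sup>2 \<partial>M) < \<infinity>"
    and le: "(\<integral>\<^sup>+\<omega>. (v \<omega>)\<^sup>2 \<partial>M) \<le> (\<integral>\<^sup>+\<omega>. alive n \<omega> * (indicator {0<..<e} (chain n \<omega>) * v \<omega>) \<partial>M)"
  shows "(\<integral>\<^sup>+\<omega>. (v \<omega>)\<^sup>2 \<partial>M) \<le> (\<integral>\<^sup>+\<omega>. (mass e \<omega>)\<^sup>2 \<partial>M)"
proof -
  note [measurable] = v measurable_from_subalg[OF FW(1) v] mass_measurable
  have "(\<integral>\<^sup>+\<omega>. alive n \<omega> * (indicator {0<..<e} (chain n \<omega>) * v \<omega>) \<partial>M)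
      = (\<integral>\<^sup>+\<omega>. \<integral>\<^sup>+x. (indicator {0<..<e} x * v \<omega>) * q n x \<omega> \<partial>lborel \<partial>M)"
    by (rule alive_expectation[where \<Psi> = "\<lambda>x \<omega>. indicator {0<..<e} x * v \<omega>"]) (simp, measurable)
  also have "\<dots> = (\<integral>\<^sup>+\<omega>. v \<omega> * mass e \<omega> \<partial>M)"
  proof (rule nn_integral_cong)
    fix \<omega> assume \<omega>: "\<omega> \<in> space M"
    have [measurable]: "(\<lambda>x. q n x \<omega>) \<in> borel_measurable borel"
      using measurable_Pair1[OF filter_density_measurable \<omega>] by simp
    show "(\<integral>\<^sup>+x. (indicator {0<..<e} x * v \<omega>) * q n x \<omega> \<partial>lborel) = v \<omega> * mass e \<omega>"
      unfolding mass_def by (subst nn_integral_cmult[symmetric]) (measurable, simp only: mult_ac)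
  qed
  finally have "2 * (\<integral>\<^sup>+\<omega>. (v \<omega>)\<^sup>2 \<partial>M) \<le> 2 * (\<integral>\<^sup>+\<omega>. v \<omega> * mass e \<omega> \<partial>M)"
    using le by (intro mult_left_mono) auto
  also have "\<dots> = (\<integral>\<^sup>+\<omega>. 2 * (v \<omega> * mass e \<omega>) \<partial>M)" by (simp add: nn_integral_cmult)
  also have "\<dots> \<le> (\<integral>\<^sup>+\<omega>. (v \<omega>)\<^sup>2 + (mass e \<omega>)\<^sup>2 \<partial>M)"
    by (intro nn_integral_mono ennreal_two_mult_le)
  also have "\<dots> = (\<integral>\<^sup>+\<omega>. (v \<omega>)\<^sup>2 \<partial>M) + (\<integral>\<^sup>+\<omega>. (mass e \<omega>)\<^sup>2 \<partial>M)"
    by (rule nn_integral_add) auto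
  finally show ?thesis using fin by (auto simp: mult_2 ennreal_add_left_cancel_le)
qed

end

section \<open>Natural filtrations and conditional probabilities\<close>

lemma (in prob_space) indep_set_mono:
  assumes "indep_set A B" "A' \<subseteq> A" "B' \<subseteq> B"
  shows "indep_set A' B'"
  using assms unfolding indep_sets2_eq by blast

text \<open>Here \<open>A\<close> stands for the common noise, \<open>B\<close> for the own noise, \<open>H\<close> for the past of the latter, \<open>E\<close> for its next
  increment, and \<open>X\<close> for the initial position. The intersections \<open>a \<inter> h \<inter> x\<close> form a generator stable under
  intersection, on which the probabilities factorise by peeling off \<open>x\<close>, then \<open>a\<close>, then \<open>h\<close>.\<close>

lemma (in prob_space) indep_set_sigma_Un3:
  assumes A: "subalgebra M A" and B: "subalgebra M B" "sets H \<subseteq> sets B" "sets E \<subseteq> sets B"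
    and X: "subalgebra M X" and sp: "space H = space M"
    and AB: "indep_set (sets A) (sets B)" and HE: "indep_set (sets H) (sets E)"
    and XAB: "indep_set (sets X) (sets (sigma (space M) (sets A \<union> sets B)))"
  shows "indep_set (sets (sigma (space M) (sets A \<union> sets H \<union> sets X))) (sets E)"
proof -
  let ?P = "{a \<inter> h \<inter> x | a h x. a \<in> sets A \<and> h \<in> sets H \<and> x \<in> sets X}"
  let ?S = "sigma_sets (space M) (sets A \<union> sets B)"
  have ev: "sets A \<subseteq> events" "sets B \<subseteq> events" "sets X \<subseteq> events"
    and spA: "space A = space M" and spX: "space X = space M"
    using A B X by (auto simp: subalgebra_def)
  have pow: "sets A \<union> sets B \<subseteq> Pow (space M)" "sets A \<union> sets H \<union> sets X \<subseteq> Pow (space M)"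
    using ev B(2) sets.space_closed[of M] by (meson Un_least order_trans)+
  have setsS: "sets (sigma (space M) (sets A \<union> sets B)) = ?S"
    using pow by (simp add: sets_measure_of)
  have pS: "prob (a \<inter> h \<inter> x) = prob x * prob a * prob h" if "a \<in> sets A" "h \<in> sets B" "x \<in> sets X" for a h x
  proof -
    have "a \<inter> h \<in> sets (sigma (space M) (sets A \<union> sets B))"
      using that by (intro sets.Int) (auto simp: setsS intro: sigma_sets.Basic)
    then have "prob (x \<inter> (a \<inter> h)) = prob x * prob (a \<inter> h)"
      by (rule indep_setD[OF XAB that(3)])
    then show ?thesis using indep_setD[OF AB that(1,2)] by (simp add: Int_ac)
  qed
  have stable: "Int_stable ?P"
  proof (rule Int_stableI)
    fix u v assume "u \<in> ?P" "v \<in> ?P"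
    then obtain a h x a' h' x' where m: "a \<in> sets A" "h \<in> sets H" "x \<in> sets X" "a' \<in> sets A" "h' \<in> sets H"
      "x' \<in> sets X" and e: "u = a \<inter> h \<inter> x" "v = a' \<inter> h' \<inter> x'" by blast
    have "u \<inter> v = (a \<inter> a') \<inter> (h \<inter> h') \<inter> (x \<inter> x')" unfolding e by blast
    then show "u \<inter> v \<in> ?P" using m by blast
  qed
  have P: "indep_set ?P (sets E)"
  proof (rule indep_setI)
    show "sets E \<subseteq> events" using ev B by auto
    show "?P \<subseteq> events"
    proof clarify
      fix a h x assume "a \<in> sets A" "h \<in> sets H" "x \<in> sets X"
      then have "a \<in> events" "h \<in> events" "x \<in> events" using ev B(2) by blast+
      then show "a \<inter> h \<inter> x \<in> events" by auto
    qed
    fix u e assume "u \<in> ?P" and e: "e \<in> sets E"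
    then obtain a h x where m: "a \<in> sets A" "h \<in> sets H" "x \<in> sets X" and u: "u = a \<inter> h \<inter> x" by blast
    have "prob (u \<inter> e) = prob (a \<inter> (h \<inter> e) \<inter> x)" unfolding u by (simp add: Int_ac)
    also have "\<dots> = prob x * prob a * prob (h \<inter> e)" using m e B by (intro pS) auto
    also have "prob (h \<inter> e) = prob h * prob e" using indep_setD[OF HE m(2) e] .
    also have "prob x * prob a * (prob h * prob e) = prob u * prob e"
      unfolding u using m B by (subst pS) auto
    finally show "prob (u \<inter> e) = prob u * prob e" .
  qed
  have "indep_set (sigma_sets (space M) ?P) (sigma_sets (space M) (sets E))"
  proof (rule indep_set_sigma_sets[OF P stable])
    show "Int_stable (sets E)" by (rule sets.Int_stable)
  qed
  moreover have "sets (sigma (space M) (sets A \<union> sets H \<union> sets X)) \<subseteq> sigma_sets (space M) ?P"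
  proof -
    have top: "space M \<in> sets A" "space M \<in> sets H" "space M \<in> sets X"
      using sets.top[of A] sets.top[of H] sets.top[of X] spA sp spX by simp_all
    have "sets A \<union> sets H \<union> sets X \<subseteq> ?P"
    proof
      fix u assume u: "u \<in> sets A \<union> sets H \<union> sets X"
      have "u \<subseteq> space M" using u pow(2) by blast
      then have eq: "u = u \<inter> space M \<inter> space M" "u = space M \<inter> u \<inter> space M" "u = space M \<inter> space M \<inter> u"
        by auto
      from u consider "u \<in> sets A" | "u \<in> sets H" | "u \<in> sets X" by auto
      then show "u \<in> ?P"
      proof cases
        case 1 then show ?thesis using eq(1) top by (intro CollectI exI conjI)
      next
        case 2 then show ?thesis using eq(2) top by (intro CollectI exI conjI)
      next
        case 3 then show ?thesis using eq(3) top by (intro CollectI exI conjI)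
      qed
    qed
    then show ?thesis using pow by (simp add: sets_measure_of sigma_sets_mono')
  qed
  ultimately show ?thesis by (rule indep_set_mono) (auto intro: sigma_sets.Basic)
qed

lemma space_natural_filtration [simp]: "space (natural_filtration M W t) = space M"
  by (simp add: natural_filtration_def space_measure_of_conv)

lemma sets_natural_filtration:
  "sets (natural_filtration M W t)
    = sigma_sets (space M) {W s -` A \<inter> space M | s A. s \<in> {0..t} \<and> A \<in> sets borel}"
  unfolding natural_filtration_def by (rule sets_measure_of) auto

lemma natural_filtration_mono: "s \<le> t \<Longrightarrow> sets (natural_filtration M W s) \<subseteq> sets (natural_filtration M W t)"
  unfolding sets_natural_filtration by (rule sigma_sets_mono') fastforce

lemma natural_filtration_measurable:
  assumes "0 \<le> s" "s \<le> t" shows "W s \<in> borel_measurable (natural_filtration M W t)"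
proof (rule measurableI)
  fix A :: "real set" assume "A \<in> sets borel"
  then show "W s -` A \<inter> space (natural_filtration M W t) \<in> sets (natural_filtration M W t)"
    unfolding sets_natural_filtration using assms by (auto intro!: sigma_sets.Basic)
qed simp

lemma subalgebra_natural_filtration:
  assumes "\<And>s. 0 \<le> s \<Longrightarrow> s \<le> t \<Longrightarrow> W s \<in> borel_measurable M"
  shows "subalgebra M (natural_filtration M W t)"
  unfolding subalgebra_def sets_natural_filtration using assms
  by (auto intro!: sets.sigma_sets_subset measurable_sets)

text \<open>Interpolation between the trivial bound \<open>1\<close> and a bound \<open>y\<close>. It trades the singularity \<open>1 / t\<close> for
  \<open>1 / t\<^sup>\<gamma>\<close>.\<close>

lemma le_ennreal_powr:
  fixes x :: ennreal
  assumes "x \<le> 1" "x \<le> ennreal y" "0 < y" "0 < \<gamma>" "\<gamma> < 1"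
  shows "x \<le> ennreal (y powr \<gamma>)"
proof (cases "1 \<le> y")
  case True
  then have "1 \<le> y powr \<gamma>" using assms by (intro ge_one_powr_ge_zero) auto
  then have "1 \<le> ennreal (y powr \<gamma>)" by (simp add: ennreal_leI flip: ennreal_1)
  then show ?thesis using assms(1) order_trans by blast
next
  case False
  then have "y powr 1 \<le> y powr \<gamma>" using assms by (intro powr_mono') auto
  then have "ennreal y \<le> ennreal (y powr \<gamma>)" using assms by (intro ennreal_leI) simp
  then show ?thesis using assms(2) order_trans by blast
qed

text \<open>The density is bounded almost everywhere only; truncating it at the bound gives a version bounded at
  every point.\<close>

lemma bounded_density_version:
  assumes law: "has_law_density M X0 V0" and V0: "bounded_L2_density V0"
  shows "\<exists>C>0. \<exists>V. V \<in> borel_measurable borel \<and> (\<forall>x. V x \<le> ennreal C) \<and> (\<forall>x\<le>0. V x = 0)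
     \<and> distributed M lborel X0 V"
proof -
  obtain C where C: "AE x in lborel. 0 < x \<longrightarrow> V0 x \<le> C"
    using V0 unfolding bounded_L2_density_def by blast
  let ?D = "\<lambda>x. ennreal (indicator {0<..} x * V0 x)"
  \<comment> \<open>a positive bound, so that the final constant is positive\<close>
  let ?C = "max C 1"
  define V where "V x = min (?D x) (ennreal ?C)" for x
  have D: "distributed M lborel X0 ?D" using law by (simp add: has_law_density_def)
  have [measurable]: "?D \<in> borel_measurable lborel" using D by (simp add: distributed_def)
  have V: "V \<in> borel_measurable lborel" unfolding V_def by measurable
  have "AE x in lborel. ?D x = V x"
    using C
  proof eventually_elim
    case (elim x)
    then have "indicator {0<..} x * V0 x \<le> ?C" by (auto simp: indicator_def)
    then have "?D x \<le> ennreal ?C" by (rule ennreal_leI)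
    then show ?case by (simp add: V_def min_def)
  qed
  then have "density lborel ?D = density lborel V" using V by (intro density_cong) auto
  then have "distributed M lborel X0 V" using D V by (simp add: distributed_def)
  then show ?thesis using V
    by (intro exI[of _ ?C] exI[of _ V] conjI allI impI) (auto simp: V_def)
qed

lemma less_hitting_timeD:
  assumes "ereal t < hitting_time T X \<omega>" "0 \<le> s" "s \<le> t" "t \<le> T"
  shows "0 < X s \<omega>"
proof (rule ccontr)
  assume "\<not> 0 < X s \<omega>"
  then have "hitting_time T X \<omega> \<le> ereal s"
    unfolding hitting_time_def using assms by (intro INF_lower) auto
  then show False using assms by (meson ereal_less_eq(3) leD order_trans)
qed

text \<open>\<open>E[v\<^sup>2] = E[v 1\<^sub>A]\<close> for the conditional probability \<open>v\<close> of \<open>A\<close>. A particle alive on a whole interval is alive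
  on the grid, hence \<open>1\<^sub>A\<close> can be replaced by the indicator of survival on the grid.\<close>

lemma (in common_noise_chain) conditional_second_moment_le:
  assumes A: "A \<subseteq> space M" and sub: "AE \<omega> in M. \<omega> \<in> A \<longrightarrow> (\<forall>j\<le>n. 0 < chain j \<omega>) \<and> chain n \<omega> < e"
  shows "(\<integral>\<^sup>+\<omega>. (nn_cond_exp M FW (indicator A) \<omega>)\<^sup>2 \<partial>M) \<le> (\<integral>\<^sup>+\<omega>. (mass e \<omega>)\<^sup>2 \<partial>M)"
proof (cases "(indicator A :: 'a \<Rightarrow> ennreal) \<in> borel_measurable M")
  \<comment> \<open>the conditional expectation of a nonmeasurable function is \<open>0\<close> by convention\<close>
  case False
  then show ?thesis by (simp add: nn_cond_exp_def)
next
  case True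
  interpret FW: sigma_finite_subalgebra M FW
    by (rule finite_measure_subalgebra_is_sigma_finite) (unfold_locales, rule FW(1))
  let ?v = "nn_cond_exp M FW (indicator A)"
  have vm: "?v \<in> borel_measurable FW" by simp
  have eq: "(\<integral>\<^sup>+\<omega>. (?v \<omega>)\<^sup>2 \<partial>M) = (\<integral>\<^sup>+\<omega>. ?v \<omega> * indicator A \<omega> \<partial>M)"
    unfolding power2_eq_square using True by (intro FW.nn_cond_exp_intg) auto
  also have "\<dots> \<le> (\<integral>\<^sup>+\<omega>. 1 * ?v \<omega> \<partial>M)"
    by (intro nn_integral_mono) (auto simp: indicator_def)
  also have "\<dots> = (\<integral>\<^sup>+\<omega>. 1 * indicator A \<omega> \<partial>M)"
    using True by (intro FW.nn_cond_exp_intg) auto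
  also have "\<dots> \<le> (\<integral>\<^sup>+\<omega>. 1 \<partial>M)" by (intro nn_integral_mono) (auto simp: indicator_def)
  also have "\<dots> = 1" using emeasure_space_1 by simp
  finally have fin: "(\<integral>\<^sup>+\<omega>. (?v \<omega>)\<^sup>2 \<partial>M) < \<infinity>" by (simp add: order_le_less_trans[OF _ ennreal_one_less_top])
  have "(\<integral>\<^sup>+\<omega>. ?v \<omega> * indicator A \<omega> \<partial>M) \<le> (\<integral>\<^sup>+\<omega>. alive n \<omega> * (indicator {0<..<e} (chain n \<omega>) * ?v \<omega>) \<partial>M)"
  proof (rule nn_integral_mono_AE, use sub in eventually_elim)
    case (elim \<omega>)
    show ?case
    proof (cases "\<omega> \<in> A")
      case True
      then have "alive n \<omega> = 1" "indicator {0<..<e} (chain n \<omega>) = (1 :: ennreal)"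
        using elim by (auto simp: alive_def intro!: prod.neutral)
      then show ?thesis by (simp add: indicator_def)
    qed simp
  qed
  then show ?thesis unfolding eq[symmetric] by (rule second_moment_le_mass[OF vm fin])
qed

section \<open>Brownian motions on a time grid\<close>

lemma brownian_increment:
  assumes BM: "standard_brownian_motion M F T W" and st: "0 \<le> s" "s < t" "t \<le> T"
  shows "distributed M lborel (\<lambda>\<omega>. W t \<omega> - W s \<omega>) (normal_density 0 (sqrt (t - s)))"
    and "prob_space.indep_set M (sets (F s)) (sets (vimage_algebra (space M) (\<lambda>\<omega>. W t \<omega> - W s \<omega>) borel))"
  using assms by (auto simp: standard_brownian_motion_def)

lemma brownian_measurable:
  assumes "standard_brownian_motion M F T W" "0 \<le> s" "s \<le> T"
  shows "W s \<in> borel_measurable M"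
proof -
  have "subalgebra M (F s)" "W s \<in> borel_measurable (F s)"
    using assms by (auto simp: standard_brownian_motion_def)
  then show ?thesis by (rule measurable_from_subalg)
qed

text \<open>On the grid \<open>k * \<delta>\<close> the increments of \<open>W\<close> are independent of the filtration \<open>F\<close>, and those of \<open>W1\<close> are
  independent of its own past, of the whole path of \<open>W\<close>, and of the initial position.\<close>

lemma common_noise_chain_of_brownian_motions:
  fixes M :: "'a measure" and \<mu> \<sigma>M \<sigma>I T :: real
  assumes "complete_filtered_prob_space M F T"
    and BM: "standard_brownian_motion M F T W"
    and BM1: "standard_brownian_motion M (natural_filtration M W1 ) T W1"
    and ind: "independent_drivers M T W W1 X0"
    and t: "0 < t" "t \<le> T" and n: "0 < n" and \<delta>: "\<delta> = t / real n"
    and V: "V \<in> borel_measurable borel" "\<And>x. V x \<le> C" "\<And>x. x \<le> 0 \<Longrightarrow> V x = 0"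
    and X0: "distributed M lborel X0 V"
  shows "common_noise_chain M (natural_filtration M W t) (\<lambda>k. F (real k * \<delta>))
     (\<lambda>k. sigma (space M) (sets (natural_filtration M W t) \<union> sets (natural_filtration M W1 (real k * \<delta>))
        \<union> sets (vimage_algebra (space M) X0 borel))) X0
     (\<lambda>k \<omega>. W (real (Suc k) * \<delta>) \<omega> - W (real k * \<delta>) \<omega>)
     (\<lambda>k \<omega>. W1 (real (Suc k) * \<delta>) \<omega> - W1 (real k * \<delta>) \<omega>) V C (sqrt \<delta>) n"
proof -
  interpret prob_space M using assms(1) by (simp add: complete_filtered_prob_space_def)
  let ?N = "natural_filtration M W t" and ?N1 = "natural_filtration M W1"
    and ?X = "vimage_algebra (space M) X0 borel"
  have \<delta>0: "0 < \<delta>" and n\<delta>: "real n * \<delta> = t" using t n by (auto simp: \<delta>)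
  have grid: "0 \<le> real k * \<delta>" "real k * \<delta> < real (Suc k) * \<delta>" "real (Suc k) * \<delta> \<le> t"
    "real (Suc k) * \<delta> \<le> T" "real k * \<delta> \<le> T" "real k * \<delta> \<le> t" if "k < n" for k
  proof -
    have "real (Suc k) * \<delta> \<le> real n * \<delta>" using that \<delta>0 by (intro mult_right_mono) auto
    moreover show "real k * \<delta> < real (Suc k) * \<delta>" using \<delta>0 by (simp add: distrib_right)
    ultimately show "real (Suc k) * \<delta> \<le> t" "real (Suc k) * \<delta> \<le> T" "real k * \<delta> \<le> T" "real k * \<delta> \<le> t"
      using n\<delta> t by linarith+
    show "0 \<le> real k * \<delta>" using \<delta>0 by simp
  qed
  have len: "real (Suc k) * \<delta> - real k * \<delta> = \<delta>" for k by (simp add: distrib_right)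
  have Pw: "sets (natural_filtration M U s) \<subseteq> Pow (space M)" for U :: "real \<Rightarrow> 'a \<Rightarrow> real" and s
    using sets.space_closed[of "natural_filtration M U s"] by simp
  have N: "subalgebra M ?N" using t by (intro subalgebra_natural_filtration brownian_measurable[OF BM]) auto
  have N1T: "subalgebra M (?N1 T)" by (intro subalgebra_natural_filtration brownian_measurable[OF BM1]) auto
  have X0m: "X0 \<in> borel_measurable M" using distributed_measurable[OF X0] by simp
  have X: "subalgebra M ?X"
    using X0m by (auto simp: subalgebra_def sets_vimage_algebra intro!: sets.sigma_sets_subset measurable_sets)
  have NsubT: "sets ?N \<subseteq> sets (natural_filtration M W T)" by (rule natural_filtration_mono) (rule t)
  have i1: "indep_set (sets ?N) (sets (?N1 T))"
    using ind NsubT unfolding independent_drivers_def by (blast intro: indep_set_mono)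
  have i2: "indep_set (sets ?X) (sets (sigma (space M) (sets ?N \<union> sets (?N1 T))))"
  proof -
    have "sets (sigma (space M) (sets ?N \<union> sets (?N1 T)))
        \<subseteq> sets (sigma (space M) (sets (natural_filtration M W T) \<union> sets (?N1 T)))"
    proof -
      have "sets (natural_filtration M W T) \<union> sets (?N1 T) \<subseteq> Pow (space M)"
        "sets ?N \<union> sets (?N1 T) \<subseteq> Pow (space M)"
        by (intro Un_least Pw)+
      note sm = this[THEN sets_measure_of]
      show ?thesis unfolding sm by (rule sigma_sets_mono'[OF Un_mono[OF NsubT order_refl]])
    qed
    then show ?thesis using ind unfolding independent_drivers_def by (blast intro: indep_set_mono)
  qed
  have i3: "indep_set (sets ?N) (sets ?X)"
  proof (rule indep_setI)
    show "sets ?N \<subseteq> events" "sets ?X \<subseteq> events" using N X by (auto simp: subalgebra_def)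
    fix a b assume a: "a \<in> sets ?N" and b: "b \<in> sets ?X"
    have "sets ?N \<union> sets (?N1 T) \<subseteq> Pow (space M)"
      by (intro Un_least Pw)
    then have "a \<in> sets (sigma (space M) (sets ?N \<union> sets (?N1 T)))"
      using a by (auto simp: sets_measure_of)
    from indep_setD[OF i2 b this] show "prob (a \<inter> b) = prob a * prob b"
      by (simp add: Int_commute mult.commute)
  qed
  have pow: "sets ?N \<union> sets (?N1 s) \<union> sets ?X \<subseteq> Pow (space M)" for s
    using sets.space_closed[of ?X] by (intro Un_least Pw) simp
  note sG = sets_measure_of[OF pow]
  show ?thesis
  proof unfold_locales
    show "0 < sqrt \<delta>" using \<delta>0 by simp
    show "V \<in> borel_measurable borel" "\<And>x. V x \<le> C" "\<And>x. x \<le> 0 \<Longrightarrow> V x = 0"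
      "distributed M lborel X0 V" by (fact V X0)+
    show "subalgebra M ?N" by (fact N)
    show "indep_set (sets ?N) (sets ?X)" by (fact i3)
    fix k assume k: "k < n"
    note g = grid[OF k]
    show "(\<lambda>\<omega>. W (real (Suc k) * \<delta>) \<omega> - W (real k * \<delta>) \<omega>) \<in> borel_measurable ?N"
      using g by (intro borel_measurable_diff natural_filtration_measurable) auto
    show "subalgebra M (F (real k * \<delta>))" using BM g by (auto simp: standard_brownian_motion_def)
    show "indep_set (sets (F (real k * \<delta>)))
       (sets (vimage_algebra (space M) (\<lambda>\<omega>. W (real (Suc k) * \<delta>) \<omega> - W (real k * \<delta>) \<omega>) borel))"
      using g by (intro brownian_increment(2)[OF BM])
    show "distributed M lborel (\<lambda>\<omega>. W (real (Suc k) * \<delta>) \<omega> - W (real k * \<delta>) \<omega>) (normal_density 0 (sqrt \<delta>))"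
      using brownian_increment(1)[OF BM g(1,2,4)] unfolding len .
    show "distributed M lborel (\<lambda>\<omega>. W1 (real (Suc k) * \<delta>) \<omega> - W1 (real k * \<delta>) \<omega>) (normal_density 0 (sqrt \<delta>))"
      using brownian_increment(1)[OF BM1 g(1,2,4)] unfolding len .
    let ?G = "sigma (space M) (sets ?N \<union> sets (?N1 (real k * \<delta>)) \<union> sets ?X)"
    have N1k: "sets (?N1 (real k * \<delta>)) \<subseteq> sets (?N1 T)" by (rule natural_filtration_mono) (rule g)
    have spG: "space ?G = space M" by (simp add: space_measure_of_conv)
    show "subalgebra M ?G"
      unfolding subalgebra_def spG sG using N N1T N1k X
      by (auto simp: subalgebra_def intro!: sets.sigma_sets_subset)
    show "subalgebra ?G ?N" unfolding subalgebra_def spG sG by (auto intro: sigma_sets.Basic)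
    have "subalgebra ?G ?X" unfolding subalgebra_def spG sG by (auto intro: sigma_sets.Basic)
    then show "X0 \<in> borel_measurable ?G"
      by (rule measurable_from_subalg) (rule measurable_vimage_algebra1, simp)
    have G1: "subalgebra ?G (?N1 (real k * \<delta>))"
      unfolding subalgebra_def spG sG by (auto intro: sigma_sets.Basic)
    show "indep_set (sets ?G)
       (sets (vimage_algebra (space M) (\<lambda>\<omega>. W1 (real (Suc k) * \<delta>) \<omega> - W1 (real k * \<delta>) \<omega>) borel))"
    proof (rule indep_set_sigma_Un3[OF N N1T N1k _ X _ i1 _ i2])
      have "(\<lambda>\<omega>. W1 (real (Suc k) * \<delta>) \<omega> - W1 (real k * \<delta>) \<omega>) \<in> borel_measurable (?N1 T)"
        using g by (intro borel_measurable_diff natural_filtration_measurable) auto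
      then show "sets (vimage_algebra (space M) (\<lambda>\<omega>. W1 (real (Suc k) * \<delta>) \<omega> - W1 (real k * \<delta>) \<omega>) borel)
          \<subseteq> sets (?N1 T)"
        by (auto simp: sets_vimage_algebra dest: measurable_sets
            intro!: sets.sigma_sets_subset[of _ "?N1 T", simplified])
      show "indep_set (sets (?N1 (real k * \<delta>)))
        (sets (vimage_algebra (space M) (\<lambda>\<omega>. W1 (real (Suc k) * \<delta>) \<omega> - W1 (real k * \<delta>) \<omega>) borel))"
        using g by (intro brownian_increment(2)[OF BM1])
    qed simp
    fix j assume j: "j < k"
    have jk: "real (Suc j) * \<delta> \<le> real k * \<delta>" using j \<delta>0 by (intro mult_right_mono) auto
    note gj = grid[OF less_trans[OF j k]]
    have jk': "real j * \<delta> \<le> real k * \<delta>" using jk gj by linarith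
    have Fs: "subalgebra (F (real k * \<delta>)) (F s)" if "0 \<le> s" "s \<le> real k * \<delta>" for s
    proof -
      have "filtration (space M) F" using assms(1) by (simp add: complete_filtered_prob_space_def)
      then show ?thesis using that by (auto simp: subalgebra_def filtration_def)
    qed
    have F: "W s \<in> borel_measurable (F (real k * \<delta>))" if "0 \<le> s" "s \<le> real k * \<delta>" for s
    proof (rule measurable_from_subalg[OF Fs[OF that]])
      show "W s \<in> borel_measurable (F s)" using BM g that by (auto simp: standard_brownian_motion_def)
    qed
    show "(\<lambda>\<omega>. W (real (Suc j) * \<delta>) \<omega> - W (real j * \<delta>) \<omega>) \<in> borel_measurable (F (real k * \<delta>))"
      using jk jk' gj \<delta>0 by (intro borel_measurable_diff F) auto
    show "(\<lambda>\<omega>. W1 (real (Suc j) * \<delta>) \<omega> - W1 (real j * \<delta>) \<omega>) \<in> borel_measurable ?G"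
      using jk jk' gj \<delta>0
      by (intro measurable_from_subalg[OF G1] borel_measurable_diff natural_filtration_measurable) auto
  qed
qed

section \<open>The boundary estimate\<close>

theorem proposition2p7:
  fixes M :: "'a measure" and F :: "real \<Rightarrow> 'a measure"
    and W W1 :: "real \<Rightarrow> 'a \<Rightarrow> real" and X0 :: "'a \<Rightarrow> real" and V0 :: "real \<Rightarrow> real"
    and \<nu> :: "real \<Rightarrow> 'a \<Rightarrow> real measure"
    and \<mu> \<sigma>M \<sigma>I T :: real
  assumes "\<sigma>M > 0" and "\<sigma>I > 0" and "T > 0"
    and "complete_filtered_prob_space M F T"
    and "standard_brownian_motion M F T W"
    and "standard_brownian_motion M (natural_filtration M W1) T W1"
    and "independent_drivers M T W W1 X0"
    and "bounded_L2_density V0"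
    and "has_law_density M X0 V0"
    and "probabilistic_solution M T W (particle \<mu> \<sigma>M \<sigma>I W W1 X0) \<nu>"
  shows "\<forall>\<beta>\<in>{0<..<pi / wedge_angle \<sigma>M \<sigma>I - 1}.
    \<exists>B \<gamma> :: real. B > 0 \<and> \<gamma> \<in> {0<..<1} \<and>
      (\<forall>\<epsilon>>0. \<forall>t\<in>{0..T}.
         (\<integral>\<^sup>+ \<omega>. (emeasure (\<nu> t \<omega>) {0<..<\<epsilon>})\<^sup>2 \<partial>M)
           \<le> (if t = 0 then \<infinity> else ennreal (B / t powr \<gamma> * \<epsilon> powr (3 + \<beta>))))"
proof
  let ?\<alpha> = "wedge_angle \<sigma>M \<sigma>I"
  fix \<beta> assume "\<beta> \<in> {0<..<pi / ?\<alpha> - 1}"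
  then have \<beta>: "0 < \<beta>" "1 + \<beta> < pi / ?\<alpha>" by auto
  then obtain p where p\<beta>: "1 + \<beta> < p" "p < pi / ?\<alpha>" using dense[OF \<beta>(2)] by blast
  have "0 < ?\<alpha>" 
  proof (rule ccontr)
    assume "\<not> 0 < ?\<alpha>"
    then have "pi / ?\<alpha> \<le> 0" by (simp add: divide_nonneg_nonpos)
    then show False using \<beta> by linarith
  qed
  then have "p * ?\<alpha> < pi" using p\<beta> by (simp add: less_divide_eq)
  then interpret wedge_barrier \<mu> \<sigma>M \<sigma>I p
    using assms(1,2) p\<beta> \<beta> by unfold_locales auto
  interpret prob_space M using assms(4) by (simp add: complete_filtered_prob_space_def)
  obtain K where K: "0 < K" and surv: "\<And>e t. \<lbrakk>0 < e; 0 < t; t \<le> T\<rbrakk> \<Longrightarrow>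
     \<exists>n>0. \<forall>x y. 0 < x \<longrightarrow> x < e \<longrightarrow> 0 < y \<longrightarrow> y < e \<longrightarrow>
        pair_survival (\<mu> * (t / real n)) (\<sigma>M * sqrt (t / real n)) (\<sigma>I * sqrt (t / real n)) n x y
          \<le> ennreal (K * e powr p / t)"
    using pair_survival_bound[of T] by blast
  obtain C V where C: "0 < C" and V: "V \<in> borel_measurable borel" "\<And>x. V x \<le> ennreal C"
    "\<And>x. x \<le> 0 \<Longrightarrow> V x = 0" "distributed M lborel X0 V"
    using bounded_density_version[OF assms(9,8)] by blast
  \<comment> \<open>chosen so that raising \<open>e\<^sup>p\<close> to the power \<open>\<gamma>\<close> gives \<open>e\<^bsup>1 + \<beta>\<^esup>\<close>; a further \<open>e\<^sup>2\<close> is the area of \<open>(0, e)\<^sup>2\<close>\<close>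
  define \<gamma> where "\<gamma> = (1 + \<beta>) / p"
  have \<gamma>: "0 < \<gamma>" "\<gamma> < 1" "p * \<gamma> = 1 + \<beta>" using p\<beta> \<beta> by (auto simp: \<gamma>_def)
  have bound: "(\<integral>\<^sup>+ \<omega>. (emeasure (\<nu> t \<omega>) {0<..<e})\<^sup>2 \<partial>M)
      \<le> ennreal (C\<^sup>2 * K powr \<gamma> / t powr \<gamma> * e powr (3 + \<beta>))"
    if e: "0 < e" and t: "0 < t" "t \<le> T" for e t :: real
  proof -
    obtain n where n: "0 < n" and sv: "\<And>x y. \<lbrakk>0 < x; x < e; 0 < y; y < e\<rbrakk> \<Longrightarrow>
        pair_survival (\<mu> * (t / real n)) (\<sigma>M * sqrt (t / real n)) (\<sigma>I * sqrt (t / real n)) n x y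
          \<le> ennreal (K * e powr p / t)"
      using surv[OF e t] by blast
    define \<delta> where "\<delta> = t / real n"
    have n\<delta>: "real n * \<delta> = t" and \<delta>0: "0 < \<delta>" using n t by (auto simp: \<delta>_def)
    let ?FW = "natural_filtration M W t"
    interpret common_noise_chain M ?FW "\<lambda>k. F (real k * \<delta>)"
      "\<lambda>k. sigma (space M) (sets ?FW \<union> sets (natural_filtration M W1 (real k * \<delta>))
        \<union> sets (vimage_algebra (space M) X0 borel))" X0
      "\<lambda>k \<omega>. W (real (Suc k) * \<delta>) \<omega> - W (real k * \<delta>) \<omega>"
      "\<lambda>k \<omega>. W1 (real (Suc k) * \<delta>) \<omega> - W1 (real k * \<delta>) \<omega>" V "ennreal C" "\<mu> * \<delta>" \<sigma>M \<sigma>I "sqrt \<delta>" n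
      by (rule common_noise_chain_of_brownian_motions[OF assms(4-7) t n \<delta>_def V])
    let ?X = "particle \<mu> \<sigma>M \<sigma>I W W1 X0"
    let ?A = "{\<omega>\<in>space M. ?X t \<omega> \<in> {0<..<e} \<and> ereal t < hitting_time T ?X \<omega>}"
    \<comment> \<open>the chain starts at \<open>X0\<close>, the particle at \<open>X0 + \<sigma>M * W 0 + \<sigma>I * W1 0\<close>\<close>
    have "chain k \<omega> = ?X (real k * \<delta>) \<omega>" if "W 0 \<omega> = 0" "W1 0 \<omega> = 0" for k \<omega>
      using that unfolding chain_def particle_def
      by (induction k) (simp_all add: algebra_simps)
    moreover have "AE \<omega> in M. W 0 \<omega> = 0" "AE \<omega> in M. W1 0 \<omega> = 0"
      using assms(5,6) by (auto simp: standard_brownian_motion_def)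
    ultimately have chain_eq: "AE \<omega> in M. \<forall>k. chain k \<omega> = ?X (real k * \<delta>) \<omega>" by auto
    have sub: "AE \<omega> in M. \<omega> \<in> ?A \<longrightarrow> (\<forall>j\<le>n. 0 < chain j \<omega>) \<and> chain n \<omega> < e"
      using chain_eq
    proof eventually_elim
      case (elim \<omega>)
      show ?case
      proof (intro impI conjI allI)
        assume A: "\<omega> \<in> ?A"
        then show "chain n \<omega> < e" using elim n\<delta> by simp
        fix j assume "j \<le> n"
        then have "real j * \<delta> \<le> t" using \<delta>0 by (simp add: n\<delta>[symmetric])
        moreover have "0 \<le> real j * \<delta>" using \<delta>0 by simp
        moreover have "ereal t < hitting_time T ?X \<omega>" using A by blast
        ultimately have "0 < ?X (real j * \<delta>) \<omega>" using t(2) by (blast intro: less_hitting_timeD)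
        then show "0 < chain j \<omega>" using elim by simp
      qed
    qed
    have "{0<..<e} \<in> sets lebesgue" "{0<..<e} \<subseteq> {0<..}" "t \<in> {0..T}" using t by auto
    then have nu_eq: "AE \<omega> in M. emeasure (\<nu> t \<omega>) {0<..<e} = nn_cond_exp M ?FW (indicator ?A) \<omega>"
      using assms(10) unfolding probabilistic_solution_def by blast
    have "(\<integral>\<^sup>+ \<omega>. (emeasure (\<nu> t \<omega>) {0<..<e})\<^sup>2 \<partial>M)
        = (\<integral>\<^sup>+ \<omega>. (nn_cond_exp M ?FW (indicator ?A) \<omega>)\<^sup>2 \<partial>M)"
      by (intro nn_integral_cong_AE eventually_mono[OF nu_eq]) (rule arg_cong[where f = "\<lambda>x. x\<^sup>2"])
    also have "\<dots> \<le> (\<integral>\<^sup>+\<omega>. (mass e \<omega>)\<^sup>2 \<partial>M)"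
      by (rule conditional_second_moment_le[OF _ sub]) auto
    also have "\<dots> \<le> (ennreal C)\<^sup>2 * ennreal ((K * e powr p / t) powr \<gamma>) * ennreal (e\<^sup>2)"
    proof (rule mass_second_moment[OF e])
      fix x y assume xy: "0 < x" "x < e" "0 < y" "y < e"
      show "pair_survival (\<mu> * \<delta>) (\<sigma>M * sqrt \<delta>) (\<sigma>I * sqrt \<delta>) n x y \<le> ennreal ((K * e powr p / t) powr \<gamma>)"
        using sv[OF xy] K e t \<gamma> unfolding \<delta>_def by (intro le_ennreal_powr pair_survival_le_1) auto
    qed
    also have "\<dots> = ennreal (C\<^sup>2 * (K * e powr p / t) powr \<gamma> * e\<^sup>2)"
      using C by (simp add: ennreal_mult ennreal_power)
    also have "C\<^sup>2 * (K * e powr p / t) powr \<gamma> * e\<^sup>2 = C\<^sup>2 * K powr \<gamma> / t powr \<gamma> * e powr (3 + \<beta>)"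
    proof -
      have "e powr (3 + \<beta>) = e powr (p * \<gamma>) * e powr 2"
        unfolding \<gamma>(3) by (simp flip: powr_add)
      also have "e powr 2 = e\<^sup>2" using e by simp
      finally show ?thesis using K e t by (simp add: powr_mult powr_divide powr_powr)
    qed
    finally show ?thesis .
  qed
  show "\<exists>B \<gamma> :: real. B > 0 \<and> \<gamma> \<in> {0<..<1} \<and>
      (\<forall>\<epsilon>>0. \<forall>t\<in>{0..T}.
         (\<integral>\<^sup>+ \<omega>. (emeasure (\<nu> t \<omega>) {0<..<\<epsilon>})\<^sup>2 \<partial>M)
           \<le> (if t = 0 then \<infinity> else ennreal (B / t powr \<gamma> * \<epsilon> powr (3 + \<beta>))))"
    using bound \<gamma> C K by (intro exI[of _ "C\<^sup>2 * K powr \<gamma>"] exI[of _ \<gamma>]) auto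
qed

end
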